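(* Let $E_n=(\Omega_n,\mathcal{F}_n,\{Q_{1,n},\dots,Q_{d,n},Q_n\})$, $(\mathcal{F}_{t,n})_{t\in I}$, $n\in\mathbb{N}$, be a sequence of financial experiments with $Q_{i,n}\triangleleft Q_n$ and $Q_n\triangleleft Q_{i,n}$ for all $i=1,\dots,d$, and let $E=\big(([0,\infty)^d)^I,(\mathcal{B}([0,\infty)^d))^I,\{\nu_1,\dots,\nu_d,\nu\}\big)$ be an accumulation point of $(E_n)$. Let $s^i_{0,n}\to s^i_0$, $a_{i,n}\to a_i$, $K_n\to K$ as $n\to\infty$ for all $1\le i\le d$, let $\phi^{(n)}:([0,\infty)^d)^I\to[0,1]$ be tests (measurable functions), and let $$H_n=\Big(\sum_{i=1}^d a_{i,n}S^i_{T,n}-K_n\Big)\phi^{(n)}(\tilde S_n),\qquad \tilde S_n=\left(\left(\frac{S^i_{t,n}}{s^i_{0,n}\exp\left(\int_0^t\rho(u)\,du\right)}\right)_{t\in I}\right)_{i=1,\dots,d}.$$ Then there exist a subsequence $(n_k)_{k\in\mathbb{N}}$, a test $\phi:([0,\infty)^d)^I\to[0,1]$ and a payoff function $H$ for the limit experiment $E$, given by $$H=\Big(\sum_{i=1}^d a_iS^i_T-K\Big)\phi(\tilde S),\quad S^i_t=s^i_0\exp\Big(\int_0^t\rho(u)\,du\Big)\pi^i_t=s^i_0\exp\Big(\int_0^t\rho(u)\,du\Big)\frac{d\nu_{i|\mathcal{G}_t}}{d\nu_{|\mathcal{G}_t}},\quad \tilde S=\left(\left(\frac{S^i_t}{s^i_0\exp\left(\int_0^t\rho(u)\,du\right)}\right)_{t\in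 I}\right)_{i=1,\dots,d},$$ such that $p_{Q_{n_k}}(H_{n_k})\to p_\nu(H)$ as $k\to\infty$, and $$p_\nu(H)=\sum_{i=1}^d a_is^i_0E_{\nu_i}\big(\phi(\tilde\pi)\big)-\exp\Big(-\int_0^T\rho(u)\,du\Big)K\,E_\nu\big(\phi(\tilde\pi)\big),\qquad \tilde\pi=\left((\pi^i_t)_{t\in I}\right)_{i=1,\dots,d}.$$ The results also hold for finite sums $\sum_{j=1}^mH_{n,j}$ of payoffs of this form ($m$ fixed, each with its own convergent coefficients and tests), with limit payoff a sum $\sum_{j=1}^mH_j$ of the corresponding form.
   Context: Fix $0<T<\infty$ and a set $I\subset[0,T]$ with $\{0,T\}\subset I$. Financial experiment (for each $n$): a probability space $(\Omega_n,\mathcal{F}_n,P_n)$ with filtration $(\mathcal{F}_{t,n})_{t\in I}$, $\mathcal{F}_n=\sigma(\mathcal{F}_{t,n}:t\in I)$, $\mathcal{F}_{0,n}=\sigma(\{N\in\mathcal{F}_n:P_n(N)=0\text{ or }1\})$; adapted (strictly) positive discounted price processes $(X^i_{t,n})_{t\in I}$, $1\le i\le d$; a probability measure $Q_n$ equivalent to $P_n$ under which all $(X^i_{t,n})_{t\in I}$ are martingales; and probability measures $Q_{i,n}$ with $\frac{dQ_{i,n}}{dQ_n}=\frac{X^i_{T,n}}{X^i_{0,n}}$. Put $Y_{T,n}=\left(\left(X^i_{s,n}/X^i_{0,n}\right)_{i=1,\dots,d}\right)_{s\in I}$ and $Q_{d+1,n}=Q_n$. $\mathcal{L}(Y\,|\,Q)$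 is the law of $Y$ under $Q$. The bond $S^0_t=\exp\left(\int_0^t\rho(u)\,du\right)$, with $\rho:[0,T]\to\mathbb{R}$ deterministic and integrable, does not depend on $n$. The prices $S^i_{t,n}=S^0_tX^i_{t,n}$ have deterministic initial values $S^i_{0,n}=s^i_{0,n}>0$, so that $\frac{dQ_{i,n|\mathcal{F}_{t,n}}}{dQ_{n|\mathcal{F}_{t,n}}}=\frac{S^i_{t,n}}{S^0_ts^i_{0,n}}$; also $s_0^i>0$. The coefficients $a_{i,n},a_i,K_n,K$ are real. Option prices: $p_{Q_n}(H_n)=E_{Q_n}\big((S^0_T)^{-1}H_n\big)$ and $p_\nu(H)=E_\nu\big((S^0_T)^{-1}H\big)$. Contiguity: $P_n\triangleleft Q_n$ means that $Q_n(A_n)\to0$ implies $P_n(A_n)\to0$ for every sequence $A_n\in\mathcal{F}_n$. On $([0,\infty)^d)^I$ with the product $\sigma$-field, $\pi_t=(\pi^i_t)_{i\le d}$ is the projection onto coordinate $t\in I$ and $\mathcal{G}_t=\sigma(\pi_s:s\in I\cap[0,t])$. We identify $([0,\infty)^d)^I$ with $([0,\infty)^I)^d$. A standard financial experiment is a family of probability measures $\{\nu_1,\dots,\nu_d,\nu\}$ on this space with $\nu_i\ll\nu$ and $\frac{d\nu_{i|\mathcal{G}_t}}{d\nu_{|\mathcal{G}_t}}=\pi^i_t$ for all $i\le d$, $t\in I$. It is an accumulation point of $(E_n)$ if there is a subnet (in the sense of Kelley) $(\mathcal{I},\le)$ of $(\mathbb{N},\le)$ such that for all $i=1,\dots,d+1$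 (with $\nu_{d+1}=\nu$) all finite dimensional marginals of $(\mathcal{L}(Y_{T,\tau}\,|\,Q_{i,\tau}))_{\tau\in\mathcal{I}}$ converge weakly to those of $\nu_i$. *)

theory Defs
  imports "HOL-Probability.Probability"
begin

section \<open>Nets and weak convergence\<close>

definition directed_set :: "'i set \<Rightarrow> ('i \<Rightarrow> 'i \<Rightarrow> bool) \<Rightarrow> bool" where
  "directed_set D le \<longleftrightarrow> D \<noteq> {} \<and> (\<forall>x\<in>D. le x x) \<and>
     (\<forall>x\<in>D. \<forall>y\<in>D. \<forall>z\<in>D. le x y \<longrightarrow> le y z \<longrightarrow> le x z) \<and>
     (\<forall>x\<in>D. \<forall>y\<in>D. \<exists>z\<in>D. le x z \<and> le y z)"

text \<open>A subnet of \<open>(\<nat>, \<le>)\<close> in the sense of Kelley: the index map \<open>h\<close> need not be monotone.\<close>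

definition kelley_subnet :: "'i set \<Rightarrow> ('i \<Rightarrow> 'i \<Rightarrow> bool) \<Rightarrow> ('i \<Rightarrow> nat) \<Rightarrow> bool" where
  "kelley_subnet D le h \<longleftrightarrow> directed_set D le \<and>
     (\<forall>m. \<exists>\<tau>0\<in>D. \<forall>\<tau>\<in>D. le \<tau>0 \<tau> \<longrightarrow> m \<le> h \<tau>)"

definition tail_filter :: "'i set \<Rightarrow> ('i \<Rightarrow> 'i \<Rightarrow> bool) \<Rightarrow> 'i filter" where
  "tail_filter D le = (INF \<tau>\<in>D. principal {\<sigma>\<in>D. le \<tau> \<sigma>})"

text \<open>Convergence along \<open>tail_filter D le\<close> is net convergence over the directed set \<open>(D, le)\<close>.\<close>

lemma eventually_tail_filter:
  assumes "directed_set D le"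
  shows "eventually P (tail_filter D le) \<longleftrightarrow> (\<exists>\<tau>0\<in>D. \<forall>\<tau>\<in>D. le \<tau>0 \<tau> \<longrightarrow> P \<tau>)"
proof -
  have "\<exists>z\<in>D. principal {\<sigma>\<in>D. le z \<sigma>} \<le> inf (principal {\<sigma>\<in>D. le x \<sigma>}) (principal {\<sigma>\<in>D. le y \<sigma>})"
    if "x \<in> D" "y \<in> D" for x y
  proof -
    obtain z where z: "z \<in> D" "le x z" "le y z"
      using assms \<open>x \<in> D\<close> \<open>y \<in> D\<close> unfolding directed_set_def by blast
    have "{\<sigma>\<in>D. le z \<sigma>} \<subseteq> {\<sigma>\<in>D. le x \<sigma>} \<inter> {\<sigma>\<in>D. le y \<sigma>}"
      using assms z \<open>x \<in> D\<close> \<open>y \<in> D\<close> unfolding directed_set_def by blast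
    then show ?thesis
      using z(1) by (auto simp: inf_principal)
  qed
  moreover have "D \<noteq> {}"
    using assms by (simp add: directed_set_def)
  ultimately show ?thesis
    unfolding tail_filter_def
    by (subst eventually_INF_base) (auto simp: eventually_principal)
qed

definition weak_conv_along :: "'a topology \<Rightarrow> ('i \<Rightarrow> 'a measure) \<Rightarrow> 'a measure \<Rightarrow> 'i filter \<Rightarrow> bool" where
  "weak_conv_along X M N F \<longleftrightarrow>
     (\<forall>f. continuous_map X euclideanreal f \<and> bounded (f ` topspace X) \<longrightarrow>
        ((\<lambda>\<tau>. \<integral>x. f x \<partial>M \<tau>) \<longlongrightarrow> (\<integral>x. f x \<partial>N)) F)"

definition contiguous :: "(nat \<Rightarrow> 'w measure) \<Rightarrow> (nat \<Rightarrow> 'w measure) \<Rightarrow> bool" where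
  "contiguous P Q \<longleftrightarrow>
     (\<forall>A. (\<forall>n. A n \<in> sets (Q n)) \<and> (\<lambda>n. measure (Q n) (A n)) \<longlonglongrightarrow> 0 \<longrightarrow>
        (\<lambda>n. measure (P n) (A n)) \<longlonglongrightarrow> 0)"

section \<open>The path space\<close>

definition orthant :: "(real ^ 'd) set" where
  "orthant = {x. \<forall>i. 0 \<le> x $ i}"

text \<open>\<open>([0,\<infinity>)\<^sup>d)\<^sup>I\<close>. Its elements \<open>\<omega>\<close> carry both readings of the identification
  with \<open>([0,\<infinity>)\<^sup>I)\<^sup>d\<close>: the coordinate \<open>\<pi>\<^sup>i\<^sub>t\<close> is \<open>\<omega> t $ i\<close>.\<close>

definition path_space :: "real set \<Rightarrow> (real \<Rightarrow> real ^ 'd) measure" where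
  "path_space I = PiM I (\<lambda>_. restrict_space borel orthant)"

definition path_filtration :: "real set \<Rightarrow> real \<Rightarrow> (real \<Rightarrow> real ^ 'd) measure" where
  "path_filtration I t = sigma (space (path_space I))
     {(\<lambda>\<omega>. \<omega> s) -` A \<inter> space (path_space I) |s A.
        s \<in> I \<inter> {0..t} \<and> A \<in> sets (restrict_space borel orthant)}"

definition tests :: "real set \<Rightarrow> ((real \<Rightarrow> real ^ 'd) \<Rightarrow> real) set" where
  "tests I = path_space I \<rightarrow>\<^sub>M restrict_space borel {0..1}"

definition marginal :: "real set \<Rightarrow> (real \<Rightarrow> real ^ 'd) measure \<Rightarrow> (real \<Rightarrow> real ^ 'd) measure" where
  "marginal J M = distr M (path_space J) (\<lambda>\<omega>. restrict \<omega> J)"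

definition fidi_conv_along ::
    "real set \<Rightarrow> ('i \<Rightarrow> (real \<Rightarrow> real ^ 'd) measure) \<Rightarrow> (real \<Rightarrow> real ^ 'd) measure \<Rightarrow> 'i filter \<Rightarrow> bool" where
  "fidi_conv_along I M N F \<longleftrightarrow>
     (\<forall>J. finite J \<and> J \<subseteq> I \<longrightarrow>
        weak_conv_along (product_topology (\<lambda>_. top_of_set orthant) J)
          (\<lambda>\<tau>. marginal J (M \<tau>)) (marginal J N) F)"

section \<open>Financial experiments\<close>

definition martingale_on ::
    "'w measure \<Rightarrow> real set \<Rightarrow> (real \<Rightarrow> 'w measure) \<Rightarrow> (real \<Rightarrow> 'w \<Rightarrow> real) \<Rightarrow> bool" where
  "martingale_on M I F Z \<longleftrightarrow>
     (\<forall>t\<in>I. Z t \<in> borel_measurable (F t) \<and> integrable M (Z t)) \<and>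
     (\<forall>s\<in>I. \<forall>t\<in>I. s \<le> t \<longrightarrow> (AE \<omega> in M. real_cond_exp M (F s) (Z t) \<omega> = Z s \<omega>))"

text \<open>The underlying \<open>\<sigma>\<close>-field is \<open>sets P\<close>, and \<open>X t \<omega> $ i\<close> is the discounted price of
  asset \<open>i\<close> at time \<open>t\<close>. In the library, \<open>absolutely_continuous M N\<close> means that \<open>N\<close> is
  dominated by \<open>M\<close>.\<close>

locale financial_experiment = prob_space P
  for P :: "'w measure" +
  fixes T :: real and I :: "real set" and F :: "real \<Rightarrow> 'w measure"
    and X :: "real \<Rightarrow> 'w \<Rightarrow> real ^ 'd" and Q :: "'w measure" and Qs :: "'d \<Rightarrow> 'w measure"
  assumes filtration_subalgebra: "t \<in> I \<Longrightarrow> subalgebra P (F t)"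
    and filtration_mono: "s \<in> I \<Longrightarrow> t \<in> I \<Longrightarrow> s \<le> t \<Longrightarrow> sets (F s) \<subseteq> sets (F t)"
    and filtration_generates: "sets P = sigma_sets (space P) (\<Union>t\<in>I. sets (F t))"
    and filtration_0: "sets (F 0) =
          sigma_sets (space P) {N \<in> sets P. emeasure P N = 0 \<or> emeasure P N = 1}"
    and X_adapted: "t \<in> I \<Longrightarrow> (\<lambda>\<omega>. X t \<omega> $ i) \<in> borel_measurable (F t)"
    and X_pos: "t \<in> I \<Longrightarrow> \<omega> \<in> space P \<Longrightarrow> 0 < X t \<omega> $ i"
    and Q_prob: "prob_space Q"
    and Q_sets: "sets Q = sets P"
    and Q_equivalent: "absolutely_continuous P Q" "absolutely_continuous Q P"
    and X_martingale: "martingale_on Q I F (\<lambda>t \<omega>. X t \<omega> $ i)"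
    and Qs_prob: "prob_space (Qs i)"
    and Qs_density: "Qs i = density Q (\<lambda>\<omega>. ennreal (X T \<omega> $ i / X 0 \<omega> $ i))"

text \<open>The process \<open>Y\<^sub>T\<close>.\<close>

definition relative_prices ::
    "real set \<Rightarrow> (real \<Rightarrow> 'w \<Rightarrow> real ^ 'd) \<Rightarrow> 'w \<Rightarrow> (real \<Rightarrow> real ^ 'd)" where
  "relative_prices I X \<omega> = (\<lambda>s\<in>I. \<chi> i. X s \<omega> $ i / X 0 \<omega> $ i)"

definition standard_experiment ::
    "real set \<Rightarrow> (real \<Rightarrow> real ^ 'd) measure \<Rightarrow> ('d \<Rightarrow> (real \<Rightarrow> real ^ 'd) measure) \<Rightarrow> bool" where
  "standard_experiment I \<nu> \<nu>s \<longleftrightarrow>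
     prob_space \<nu> \<and> sets \<nu> = sets (path_space I) \<and>
     (\<forall>i. prob_space (\<nu>s i) \<and> sets (\<nu>s i) = sets (path_space I) \<and> absolutely_continuous \<nu> (\<nu>s i) \<and>
        (\<forall>t\<in>I. restr_to_subalg (\<nu>s i) (path_filtration I t) =
           density (restr_to_subalg \<nu> (path_filtration I t)) (\<lambda>\<omega>. ennreal (\<omega> t $ i))))"

text \<open>The experiment \<open>{\<nu>\<^sub>1, \<dots>, \<nu>\<^sub>d, \<nu>}\<close> is an accumulation point of the sequence if there
  are \<open>D\<close>, \<open>le\<close> and \<open>h\<close> with the following property. The subnet is an argument since a formula cannot
  quantify existentially over the type of its index set; as a hypothesis with free \<open>D\<close>, \<open>le\<close>
  and \<open>h\<close> the existential statement and this one are interchangeable.\<close>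

definition accumulation_point_along ::
    "'i set \<Rightarrow> ('i \<Rightarrow> 'i \<Rightarrow> bool) \<Rightarrow> ('i \<Rightarrow> nat) \<Rightarrow> real set \<Rightarrow>
     (nat \<Rightarrow> real \<Rightarrow> 'w \<Rightarrow> real ^ 'd) \<Rightarrow> (nat \<Rightarrow> 'w measure) \<Rightarrow> (nat \<Rightarrow> 'd \<Rightarrow> 'w measure) \<Rightarrow>
     (real \<Rightarrow> real ^ 'd) measure \<Rightarrow> ('d \<Rightarrow> (real \<Rightarrow> real ^ 'd) measure) \<Rightarrow> bool" where
  "accumulation_point_along D le h I X Q Qs \<nu> \<nu>s \<longleftrightarrow>
     standard_experiment I \<nu> \<nu>s \<and> kelley_subnet D le h \<and>
     (\<forall>i. fidi_conv_along I
        (\<lambda>\<tau>. distr (Qs (h \<tau>) i) (path_space I) (relative_prices I (X (h \<tau>)))) (\<nu>s i) (tail_filter D le)) \<and>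
     fidi_conv_along I
        (\<lambda>\<tau>. distr (Q (h \<tau>)) (path_space I) (relative_prices I (X (h \<tau>)))) \<nu> (tail_filter D le)"

section \<open>Prices and payoffs\<close>

definition bond :: "(real \<Rightarrow> real) \<Rightarrow> real \<Rightarrow> real" where
  "bond \<rho> t = exp (LINT u:{0..t}|lebesgue. \<rho> u)"

definition price :: "(real \<Rightarrow> real) \<Rightarrow> (real \<Rightarrow> 'w \<Rightarrow> real ^ 'd) \<Rightarrow> real \<Rightarrow> 'w \<Rightarrow> real ^ 'd" where
  "price \<rho> X t \<omega> = (\<chi> i. bond \<rho> t * X t \<omega> $ i)"

definition limit_price ::
    "(real \<Rightarrow> real) \<Rightarrow> real ^ 'd \<Rightarrow> real \<Rightarrow> (real \<Rightarrow> real ^ 'd) \<Rightarrow> real ^ 'd" where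
  "limit_price \<rho> s t \<omega> = (\<chi> i. s $ i * bond \<rho> t * \<omega> t $ i)"

text \<open>The path \<open>S\<^sup>~\<close> built from a price process \<open>S\<close> with initial values \<open>s\<close>.\<close>

definition normalized_prices ::
    "real set \<Rightarrow> (real \<Rightarrow> real) \<Rightarrow> real ^ 'd \<Rightarrow> (real \<Rightarrow> 'w \<Rightarrow> real ^ 'd) \<Rightarrow> 'w \<Rightarrow> (real \<Rightarrow> real ^ 'd)" where
  "normalized_prices I \<rho> s S \<omega> = (\<lambda>t\<in>I. \<chi> i. S t \<omega> $ i / (s $ i * bond \<rho> t))"

definition payoff ::
    "real \<Rightarrow> real set \<Rightarrow> (real \<Rightarrow> real) \<Rightarrow> real ^ 'd \<Rightarrow> (real \<Rightarrow> 'w \<Rightarrow> real ^ 'd) \<Rightarrow>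
     real ^ 'd \<Rightarrow> real \<Rightarrow> ((real \<Rightarrow> real ^ 'd) \<Rightarrow> real) \<Rightarrow> 'w \<Rightarrow> real" where
  "payoff T I \<rho> s S a K \<phi> \<omega> =
     ((\<Sum>i\<in>UNIV. a $ i * S T \<omega> $ i) - K) * \<phi> (normalized_prices I \<rho> s S \<omega>)"

definition option_price :: "(real \<Rightarrow> real) \<Rightarrow> real \<Rightarrow> 'w measure \<Rightarrow> ('w \<Rightarrow> real) \<Rightarrow> real" where
  "option_price \<rho> T M H = (\<integral>\<omega>. inverse (bond \<rho> T) * H \<omega> \<partial>M)"

definition coordinate_path :: "real set \<Rightarrow> (real \<Rightarrow> real ^ 'd) \<Rightarrow> (real \<Rightarrow> real ^ 'd)" where
  "coordinate_path I \<omega> = (\<lambda>t\<in>I. \<chi> i. \<omega> t $ i)"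

end

theory Submission
  imports Defs
begin

text \<open>
The discounted payoff is linear in the test and in the vector \<open>W = (1, Y\<^sub>T)\<close> made of the
bond and the relative terminal prices: up to a null set it is the inner product of a deterministic
coefficient vector with \<open>\<psi> W\<close>, where \<open>\<psi>\<close> is the test evaluated at the normalized path
(\<open>discounted_payoff_eq_inner\<close>). So everything about the price is contained in the finite-dimensional
moment vector \<open>E\<^sub>Q(\<psi> W)\<close>, whose components are the expectations of \<open>\<psi>\<close> under \<open>Q\<close> and under the
\<open>Q\<^sub>i\<close>. These vectors stay in a compact set, and what has to be shown is that each of their limits
along the net is the moment vector \<open>E\<^sub>\<nu>(\<phi> w)\<close>, \<open>w(\<omega>) = (1, \<omega> T)\<close>, of one test \<open>\<phi>\<close> in the limit
experiment.

The attainable moment vectors of the limit experiment form a convex set. It is closed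
(\<open>closed_moment_set\<close>): minimizing the second moment among the tests whose moment vectors lie near a
given point of the closure yields, by the parallelogram law, a Cauchy sequence of tests.
Hence a vector \<open>z\<close> is attainable as soon as no hyperplane separates it, and the extreme
value of a linear functional \<open>c\<close> on the set is reached by the Neyman--Pearson test
\<open>{c \<bullet> w < 0}\<close>; this turns attainability into the inequalities \<open>E(min (c \<bullet> w) 0) \<le> c \<bullet> z\<close>
(\<open>moment_setI_lower_bound\<close>). The same inequalities hold in each market for its own moment vectors, so
it only remains to pass to the limit in the left-hand side.

The function \<open>u \<mapsto> min (c \<bullet> u) 0\<close> is continuous but unbounded. The mass
that weak convergence could lose is controlled by the means: the components of \<open>W\<close> are nonnegative
with mean one, and so are those of \<open>w\<close>, because the \<open>Q\<^sub>i\<close> and the \<open>\<nu>\<^sub>i\<close> are probability measures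
with these components as densities. A Fatou argument then gives the required half of the convergence
(\<open>weak_limit_lower_bound\<close>).

Finitely many claims, or a whole sequence of them, are treated at once by taking the
cluster point in a countable product (\<open>limits_of_tests_attained\<close>). That product is metrizable, so a
cluster point of the net is the limit of an honest subsequence (\<open>subsequence_of_net_limit\<close>).
\<close>

section \<open>Moment vectors of tests\<close>

abbreviation tests_on :: "'a measure \<Rightarrow> ('a \<Rightarrow> real) set" where
  "tests_on M \<equiv> M \<rightarrow>\<^sub>M restrict_space borel {0..1}"

lemma tests_on_iff:
  "\<phi> \<in> tests_on M \<longleftrightarrow> \<phi> \<in> borel_measurable M \<and> (\<forall>x\<in>space M. 0 \<le> \<phi> x \<and> \<phi> x \<le> 1)"
  by (auto simp: measurable_restrict_space2_iff)

lemma tests_onD: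
  assumes "\<phi> \<in> tests_on M"
  shows "\<phi> \<in> borel_measurable M" "x \<in> space M \<Longrightarrow> 0 \<le> \<phi> x" "x \<in> space M \<Longrightarrow> \<phi> x \<le> 1"
  using assms by (simp_all add: tests_on_iff)

lemma integrable_test_scaleR:
  fixes w :: "'a \<Rightarrow> 'v :: euclidean_space"
  assumes \<phi>: "\<phi> \<in> tests_on M" and w: "integrable M w"
  shows "integrable M (\<lambda>x. \<phi> x *\<^sub>R w x)"
proof (rule Bochner_Integration.integrable_bound[OF w])
  show "(\<lambda>x. \<phi> x *\<^sub>R w x) \<in> borel_measurable M"
    using tests_onD(1)[OF \<phi>] w by (intro borel_measurable_scaleR) auto
  show "AE x in M. norm (\<phi> x *\<^sub>R w x) \<le> norm (w x)"
    using tests_onD(2,3)[OF \<phi>] by (intro AE_I2) (auto intro!: mult_left_le_one_le)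
qed

lemma integrable_test:
  assumes "prob_space M" "\<phi> \<in> tests_on M"
  shows "integrable M \<phi>"
proof -
  interpret prob_space M by fact
  show ?thesis
    using integrable_test_scaleR[OF assms(2), of "\<lambda>_. 1::real"] by simp
qed

text \<open>For \<open>w\<close> the vector of densities of finitely many measures with respect to \<open>M\<close>, this is the
set of power vectors of the tests.\<close>

definition moment_set :: "'a measure \<Rightarrow> ('a \<Rightarrow> 'v :: euclidean_space) \<Rightarrow> 'v set" where
  "moment_set M w = {\<integral>x. \<phi> x *\<^sub>R w x \<partial>M | \<phi>. \<phi> \<in> tests_on M}"

lemma moment_setI: "\<phi> \<in> tests_on M \<Longrightarrow> (\<integral>x. \<phi> x *\<^sub>R w x \<partial>M) \<in> moment_set M w"
  unfolding moment_set_def by blast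

lemma moment_setE:
  assumes "z \<in> moment_set M w"
  obtains \<phi> where "\<phi> \<in> tests_on M" "z = (\<integral>x. \<phi> x *\<^sub>R w x \<partial>M)"
  using assms unfolding moment_set_def by blast

lemma tests_on_convex:
  assumes "\<phi> \<in> tests_on M" "\<psi> \<in> tests_on M" "0 \<le> u" "0 \<le> v" "u + v = 1"
  shows "(\<lambda>x. u * \<phi> x + v * \<psi> x) \<in> tests_on M"
  unfolding tests_on_iff
proof safe
  show "(\<lambda>x. u * \<phi> x + v * \<psi> x) \<in> borel_measurable M"
    using tests_onD(1)[OF assms(1)] tests_onD(1)[OF assms(2)] by measurable
  fix x assume x: "x \<in> space M"
  show "0 \<le> u * \<phi> x + v * \<psi> x"
    using assms tests_onD[OF assms(1)] tests_onD[OF assms(2)] x by simp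
  show "u * \<phi> x + v * \<psi> x \<le> 1"
    using assms tests_onD[OF assms(1)] tests_onD[OF assms(2)] x
    by (intro convex_bound_le) auto
qed

lemma moment_combination:
  fixes w :: "'a \<Rightarrow> 'v :: euclidean_space"
  assumes w: "integrable M w" and "\<phi> \<in> tests_on M" "\<psi> \<in> tests_on M"
  shows "(\<integral>x. (u * \<phi> x + v * \<psi> x) *\<^sub>R w x \<partial>M)
    = u *\<^sub>R (\<integral>x. \<phi> x *\<^sub>R w x \<partial>M) + v *\<^sub>R (\<integral>x. \<psi> x *\<^sub>R w x \<partial>M)"
proof -
  note i = integrable_test_scaleR[OF assms(2) w] integrable_test_scaleR[OF assms(3) w]
  have "(\<integral>x. (u * \<phi> x + v * \<psi> x) *\<^sub>R w x \<partial>M)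
      = (\<integral>x. u *\<^sub>R (\<phi> x *\<^sub>R w x) + v *\<^sub>R (\<psi> x *\<^sub>R w x) \<partial>M)"
    by (simp add: scaleR_add_left)
  also have "\<dots> = u *\<^sub>R (\<integral>x. \<phi> x *\<^sub>R w x \<partial>M) + v *\<^sub>R (\<integral>x. \<psi> x *\<^sub>R w x \<partial>M)"
    using Bochner_Integration.integral_add[OF integrable_scaleR_right[OF i(1), of u] integrable_scaleR_right[OF i(2), of v]]
    by (simp only: integral_scaleR_right)
  finally show ?thesis .
qed

lemma convex_moment_set:
  fixes w :: "'a \<Rightarrow> 'v :: euclidean_space"
  assumes w: "integrable M w"
  shows "convex (moment_set M w)"
proof (rule convexI)
  fix x y and u v :: real
  assume "x \<in> moment_set M w" "y \<in> moment_set M w" and uv: "0 \<le> u" "0 \<le> v" "u + v = 1"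
  then obtain \<phi> \<psi> where t: "\<phi> \<in> tests_on M" "\<psi> \<in> tests_on M"
    and "x = (\<integral>x. \<phi> x *\<^sub>R w x \<partial>M)" "y = (\<integral>x. \<psi> x *\<^sub>R w x \<partial>M)"
    by (elim moment_setE)
  then have "u *\<^sub>R x + v *\<^sub>R y = (\<integral>x. (u * \<phi> x + v * \<psi> x) *\<^sub>R w x \<partial>M)"
    by (simp only: moment_combination[OF w t])
  with moment_setI[OF tests_on_convex[OF t uv], of w] show "u *\<^sub>R x + v *\<^sub>R y \<in> moment_set M w"
    by (simp only:)
qed

text \<open>Replaces weak-star compactness of the set of tests. Let \<open>z\<close> be in the closure and let
\<open>C k\<close> be the convex set of tests with moment vector within \<open>1 / (k + 1)\<close> of \<open>z\<close>. Tests
\<open>\<theta> k \<in> C k\<close> whose second moments nearly attain the infimum \<open>a k\<close> over \<open>C k\<close> are Cauchy: the midpoint of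
\<open>\<theta> k\<close> and \<open>\<theta> l\<close> is again in \<open>C k\<close> for \<open>k \<le> l\<close>, so its second moment is at least \<open>a k\<close>, and the
parallelogram law bounds the distance by \<open>a l - a k\<close> and the errors. An almost everywhere convergent
subsequence yields the test by dominated convergence.\<close>

lemma closed_moment_set:
  fixes w :: "'a \<Rightarrow> 'v :: euclidean_space"
  assumes M: "prob_space M" and w: "integrable M w"
  shows "closed (moment_set M w)"
proof -
  interpret prob_space M by fact
  define V where "V \<phi> = (\<integral>x. \<phi> x *\<^sub>R w x \<partial>M)" for \<phi> :: "'a \<Rightarrow> real"
  have "z \<in> moment_set M w" if z: "z \<in> closure (moment_set M w)" for z
  proof -
    define e where "e k = 1 / real (Suc k)" for k
    have e_pos: "0 < e k" and e_mono: "k \<le> l \<Longrightarrow> e l \<le> e k" for k l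
      by (auto simp: e_def field_simps)
    have e_lim: "e \<longlonglongrightarrow> 0"
      unfolding e_def using LIMSEQ_Suc[OF lim_1_over_n] by simp
    define C where "C k = {\<phi> \<in> tests_on M. dist (V \<phi>) z \<le> e k}" for k
    define S where "S \<phi> = (\<integral>x. (\<phi> x)\<^sup>2 \<partial>M)" for \<phi> :: "'a \<Rightarrow> real"
    define a where "a k = (INF \<phi>\<in>C k. S \<phi>)" for k
    have C_ne: "C k \<noteq> {}" for k
    proof -
      obtain y where "y \<in> moment_set M w" "dist y z < e k"
        using z e_pos[of k] by (meson closure_approachable)
      then show ?thesis
        by (elim moment_setE) (auto simp: C_def V_def intro: less_imp_le)
    qed
    have C_mono: "C l \<subseteq> C k" if "k \<le> l" for k l
      using e_mono[OF that] by (auto simp: C_def)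
    have sq_int: "integrable M (\<lambda>x. \<phi> x * \<psi> x)" if "\<phi> \<in> tests_on M" "\<psi> \<in> tests_on M" for \<phi> \<psi>
      using integrable_test_scaleR[OF that(1) integrable_test[OF M that(2)]] by simp
    have S_nn: "0 \<le> S \<phi>" for \<phi> by (simp add: S_def)
    have S_le: "S \<phi> \<le> 1" if "\<phi> \<in> tests_on M" for \<phi>
    proof -
      have "S \<phi> \<le> (\<integral>x. 1 \<partial>M)" unfolding S_def power2_eq_square
        using tests_onD[OF that] by (intro integral_mono sq_int that) (auto intro: mult_le_one)
      then show ?thesis by (simp add: prob_space)
    qed
    have bdd: "bdd_below (S ` C k)" for k
      by (rule bdd_belowI2[of _ 0]) (rule S_nn)
    have a_le: "a k \<le> S \<phi>" if "\<phi> \<in> C k" for \<phi> k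
      unfolding a_def using bdd that by (rule cINF_lower)
    have a_mono: "incseq a"
      unfolding a_def by (intro monoI cINF_superset_mono C_ne bdd C_mono) auto
    have a_ub: "a k \<le> 1" for k
    proof -
      obtain \<phi> where "\<phi> \<in> C k" using C_ne by blast
      then show ?thesis using a_le S_le by (force simp: C_def)
    qed
    obtain L where L: "a \<longlonglongrightarrow> L"
      using incseq_convergent[OF a_mono, of 1] a_ub by metis
    have "\<exists>\<phi>\<in>C k. S \<phi> < a k + e k" for k
    proof -
      have "(INF \<phi>\<in>C k. S \<phi>) < a k + e k" using e_pos[of k] by (simp add: a_def)
      then show ?thesis by (subst (asm) cINF_less_iff[OF C_ne bdd]) auto
    qed
    then obtain \<theta> where \<theta>: "\<And>k. \<theta> k \<in> C k" "\<And>k. S (\<theta> k) < a k + e k"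
      by metis
    have \<theta>t: "\<theta> k \<in> tests_on M" for k using \<theta>(1)[of k] by (simp add: C_def)
    have L1: "(\<integral>x. \<bar>\<theta> k x - \<theta> l x\<bar> \<partial>M)\<^sup>2 \<le> 2 * (a l - a k) + 2 * e k + 2 * e l" if kl: "k \<le> l" for k l
    proof -
      define m where "m x = (1/2) * \<theta> k x + (1/2) * \<theta> l x" for x
      have mt: "m \<in> tests_on M" unfolding m_def by (rule tests_on_convex) (auto simp: \<theta>t)
      have "V m = (1/2) *\<^sub>R V (\<theta> k) + (1/2) *\<^sub>R V (\<theta> l)"
        unfolding V_def m_def by (rule moment_combination) (auto simp: w \<theta>t)
      moreover have "V (\<theta> k) \<in> cball z (e k)" "V (\<theta> l) \<in> cball z (e k)"
        using \<theta>(1)[of k] \<theta>(1)[of l] C_mono[OF kl] by (auto simp: C_def dist_commute)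
      ultimately have "V m \<in> cball z (e k)"
        using convexD[OF convex_cball, of "V (\<theta> k)" z "e k" "V (\<theta> l)" "1/2" "1/2"] by simp
      then have mC: "m \<in> C k" using mt by (simp add: C_def dist_commute)
      note i = sq_int[OF \<theta>t[of k] \<theta>t[of k]] sq_int[OF \<theta>t[of l] \<theta>t[of l]] sq_int[OF \<theta>t[of k] \<theta>t[of l]]
      have Sm: "S m = S (\<theta> k) / 4 + S (\<theta> l) / 4 + (\<integral>x. \<theta> k x * \<theta> l x \<partial>M) / 2"
      proof -
        have "S m = (\<integral>x. \<theta> k x * \<theta> k x / 4 + \<theta> l x * \<theta> l x / 4 + \<theta> k x * \<theta> l x / 2 \<partial>M)"
          unfolding S_def m_def by (simp add: power2_eq_square field_simps)
        also have "\<dots> = S (\<theta> k) / 4 + S (\<theta> l) / 4 + (\<integral>x. \<theta> k x * \<theta> l x \<partial>M) / 2"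
          unfolding S_def power2_eq_square using i by simp
        finally show ?thesis .
      qed
      have Sd: "(\<integral>x. (\<theta> k x - \<theta> l x)\<^sup>2 \<partial>M) = S (\<theta> k) + S (\<theta> l) - 2 * (\<integral>x. \<theta> k x * \<theta> l x \<partial>M)"
        and Sdi: "integrable M (\<lambda>x. (\<theta> k x - \<theta> l x)\<^sup>2)"
      proof -
        have eq: "(\<lambda>x. (\<theta> k x - \<theta> l x)\<^sup>2) = (\<lambda>x. \<theta> k x * \<theta> k x + \<theta> l x * \<theta> l x - 2 * (\<theta> k x * \<theta> l x))"
          by (auto simp: power2_eq_square algebra_simps)
        show "integrable M (\<lambda>x. (\<theta> k x - \<theta> l x)\<^sup>2)" unfolding eq using i by simp
        show "(\<integral>x. (\<theta> k x - \<theta> l x)\<^sup>2 \<partial>M) = S (\<theta> k) + S (\<theta> l) - 2 * (\<integral>x. \<theta> k x * \<theta> l x \<partial>M)"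
          unfolding eq S_def power2_eq_square[of "\<theta> _ _"] using i by simp
      qed
      have "(\<integral>x. (\<theta> k x - \<theta> l x)\<^sup>2 \<partial>M) \<le> 2 * (a l - a k) + 2 * e k + 2 * e l"
      proof -
        have arith: "d \<le> 2 * (al - ak) + 2 * ek + 2 * el"
          if "sm = sk / 4 + sl / 4 + c / 2" "d = sk + sl - 2 * c" "ak \<le> sm" "sk < ak + ek" "sl < al + el"
          for d sm sk sl c ak al ek el :: real using that by (simp add: field_simps)
        show ?thesis by (rule arith[OF Sm Sd a_le[OF mC] \<theta>(2) \<theta>(2)])
      qed
      moreover have "(\<integral>x. \<bar>\<theta> k x - \<theta> l x\<bar> \<partial>M)\<^sup>2 \<le> (\<integral>x. (\<theta> k x - \<theta> l x)\<^sup>2 \<partial>M)"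
      proof -
        have i1: "integrable M (\<lambda>x. \<bar>\<theta> k x - \<theta> l x\<bar>)"
          using integrable_test[OF M \<theta>t[of k]] integrable_test[OF M \<theta>t[of l]] by simp
        have "0 \<le> variance (\<lambda>x. \<bar>\<theta> k x - \<theta> l x\<bar>)" by simp
        also have "\<dots> = (\<integral>x. (\<theta> k x - \<theta> l x)\<^sup>2 \<partial>M) - (\<integral>x. \<bar>\<theta> k x - \<theta> l x\<bar> \<partial>M)\<^sup>2"
          using i1 Sdi by (subst variance_eq) simp_all
        finally show ?thesis by simp
      qed
      ultimately show ?thesis by linarith
    qed
    obtain r where r: "strict_mono r" "AE x in M. Cauchy (\<lambda>i. \<theta> (r i) x)"
    proof (rule cauchy_L1_AE_cauchy_subseq[of M \<theta>])
      show "integrable M (\<theta> n)" for n using integrable_test[OF M \<theta>t] .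
      fix \<epsilon> :: real assume \<epsilon>: "0 < \<epsilon>"
      have "Cauchy a" using L LIMSEQ_imp_Cauchy by blast
      then obtain N1 where N1: "\<And>k l. k \<ge> N1 \<Longrightarrow> l \<ge> N1 \<Longrightarrow> \<bar>a k - a l\<bar> < \<epsilon>\<^sup>2 / 8"
        using \<epsilon> metric_CauchyD[of a "\<epsilon>\<^sup>2 / 8"] by (auto simp: dist_real_def)
      have "eventually (\<lambda>k. e k < \<epsilon>\<^sup>2 / 8) sequentially"
        using order_tendstoD(2)[OF e_lim, of "\<epsilon>\<^sup>2 / 8"] \<epsilon> by simp
      then obtain N2 where N2: "\<And>k. k \<ge> N2 \<Longrightarrow> e k < \<epsilon>\<^sup>2 / 8"
        by (auto simp: eventually_sequentially)
      have *: "(\<integral>x. \<bar>\<theta> k x - \<theta> l x\<bar> \<partial>M) < \<epsilon>" if "k \<ge> max N1 N2" "l \<ge> max N1 N2" "k \<le> l" for k l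
      proof -
        have "(\<integral>x. \<bar>\<theta> k x - \<theta> l x\<bar> \<partial>M)\<^sup>2 < \<epsilon>\<^sup>2"
        proof (rule order.strict_trans1[OF L1[OF that(3)]])
          have "\<bar>a l - a k\<bar> < \<epsilon>\<^sup>2 / 8" "e k < \<epsilon>\<^sup>2 / 8" "e l < \<epsilon>\<^sup>2 / 8"
            using N1[of l k] N2[of k] N2[of l] that by simp_all
          then show "2 * (a l - a k) + 2 * e k + 2 * e l < \<epsilon>\<^sup>2" by argo
        qed
        then show ?thesis using \<epsilon> by (simp add: power2_less_imp_less)
      qed
      have "(\<integral>x. norm (\<theta> k x - \<theta> l x) \<partial>M) < \<epsilon>" if "k \<ge> max N1 N2" "l \<ge> max N1 N2" for k l
        using *[of k l] *[of l k] that by (cases "k \<le> l") (simp_all add: abs_minus_commute)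
      then show "\<exists>N. \<forall>i\<ge>N. \<forall>j\<ge>N. (\<integral>x. norm (\<theta> i x - \<theta> j x) \<partial>M) < \<epsilon>"
        by blast
    qed blast
    \<comment> \<open>The truncation makes \<open>\<phi>\<close> a test also on the null set where the sequence diverges.\<close>
    define \<phi> where "\<phi> x = max 0 (min 1 (lim (\<lambda>i. \<theta> (r i) x)))" for x
    have \<theta>m[measurable]: "\<theta> k \<in> borel_measurable M" for k using tests_onD(1)[OF \<theta>t] .
    have \<phi>t: "\<phi> \<in> tests_on M"
      unfolding tests_on_iff \<phi>_def by (auto intro!: borel_measurable_max borel_measurable_min borel_measurable_lim_metric)
    have conv: "AE x in M. (\<lambda>i. \<theta> (r i) x *\<^sub>R w x) \<longlonglongrightarrow> \<phi> x *\<^sub>R w x"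
      using r(2) AE_space
    proof eventually_elim
      case (elim x)
      then have l: "(\<lambda>i. \<theta> (r i) x) \<longlonglongrightarrow> lim (\<lambda>i. \<theta> (r i) x)"
        by (simp add: Cauchy_convergent convergent_LIMSEQ_iff[symmetric])
      have "0 \<le> lim (\<lambda>i. \<theta> (r i) x)" "lim (\<lambda>i. \<theta> (r i) x) \<le> 1"
        using tests_onD(2,3)[OF \<theta>t elim(2)]
        by (auto intro: LIMSEQ_le_const[OF l] LIMSEQ_le_const2[OF l])
      then have "\<phi> x = lim (\<lambda>i. \<theta> (r i) x)" by (simp add: \<phi>_def)
      with l show ?case by (auto intro!: tendsto_intros)
    qed
    have "(\<lambda>i. V (\<theta> (r i))) \<longlonglongrightarrow> V \<phi>"
      unfolding V_def
    proof (rule integral_dominated_convergence[where w="\<lambda>x. norm (w x)"])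
      show "AE x in M. norm (\<theta> (r i) x *\<^sub>R w x) \<le> norm (w x)" for i
        using tests_onD(2,3)[OF \<theta>t] by (intro AE_I2) (auto intro!: mult_left_le_one_le)
    qed (use w conv tests_onD(1)[OF \<phi>t] in auto)
    moreover have "(\<lambda>i. V (\<theta> (r i))) \<longlonglongrightarrow> z"
    proof (rule LIMSEQ_subseq_LIMSEQ[OF _ r(1), of "\<lambda>i. V (\<theta> i)", unfolded o_def])
      have "\<forall>i. dist (V (\<theta> i)) z \<le> e i" using \<theta>(1) by (auto simp: C_def)
      then show "(\<lambda>i. V (\<theta> i)) \<longlonglongrightarrow> z"
        by (subst tendsto_dist_iff) (rule tendsto_sandwich[OF _ _ tendsto_const e_lim]; simp)
    qed
    ultimately have "z = V \<phi>" by (rule LIMSEQ_unique[symmetric])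
    then show ?thesis using moment_setI[OF \<phi>t, of w] by (simp add: V_def)
  qed
  then show ?thesis
    by (simp add: closure_subset_eq[symmetric] subsetI)
qed

text \<open>If \<open>z\<close> were separated from the closed convex moment set by a functional \<open>c\<close>, the test
\<open>{c \<bullet> w < 0}\<close>, which minimizes \<open>c\<close> over the moment set with minimum \<open>E(min (c \<bullet> w) 0)\<close>, would
contradict the bound.\<close>

lemma moment_setI_lower_bound:
  fixes w :: "'a \<Rightarrow> 'v :: euclidean_space"
  assumes M: "prob_space M" and w: "integrable M w"
    and bound: "\<And>c. (\<integral>x. min (c \<bullet> w x) 0 \<partial>M) \<le> c \<bullet> z"
  shows "z \<in> moment_set M w"
proof (rule ccontr)
  assume "z \<notin> moment_set M w"
  then obtain c b where c: "c \<bullet> z < b" "\<And>v. v \<in> moment_set M w \<Longrightarrow> c \<bullet> v > b"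
    using separating_hyperplane_closed_point[OF convex_moment_set[OF w] closed_moment_set[OF M w]]
    by metis
  have [measurable]: "w \<in> borel_measurable M" using w by auto
  define \<phi> where "\<phi> x = (if c \<bullet> w x < 0 then 1 else 0 :: real)" for x
  have \<phi>: "\<phi> \<in> tests_on M" unfolding tests_on_iff \<phi>_def by auto
  have "b < c \<bullet> (\<integral>x. \<phi> x *\<^sub>R w x \<partial>M)"
    by (intro c moment_setI \<phi>)
  also have "\<dots> = (\<integral>x. c \<bullet> (\<phi> x *\<^sub>R w x) \<partial>M)"
    by (rule integral_inner_right[symmetric]) (rule integrable_test_scaleR[OF \<phi> w])
  also have "\<dots> = (\<integral>x. min (c \<bullet> w x) 0 \<partial>M)"
    by (intro Bochner_Integration.integral_cong) (auto simp: \<phi>_def)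
  also have "\<dots> \<le> c \<bullet> z" by (rule bound)
  finally show False using c(1) by simp
qed

section \<open>Compactness along a net\<close>

text \<open>Nonnegativity of the components bounds \<open>\<bar>c \<bullet> W\<bar>\<close> by a linear functional \<open>A \<bullet> W\<close>. Adding
it makes \<open>g = A \<bullet> W + min (c \<bullet> W) 0\<close> nonnegative, so truncations of \<open>g\<close> from above bound its
expectation from below; and since the means agree, the expectation of \<open>A \<bullet> W\<close> can be
subtracted again on both sides.\<close>

lemma weak_limit_lower_bound:
  fixes w :: "'a \<Rightarrow> 'v :: euclidean_space" and W :: "'i \<Rightarrow> 'b \<Rightarrow> 'v"
  assumes M: "prob_space M" and w: "integrable M w"
    and w_nn: "\<And>x b. x \<in> space M \<Longrightarrow> b \<in> Basis \<Longrightarrow> 0 \<le> w x \<bullet> b"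
    and N: "\<And>\<tau>. prob_space (N \<tau>)" and W: "\<And>\<tau>. integrable (N \<tau>) (W \<tau>)"
    and W_nn: "\<And>\<tau> x b. x \<in> space (N \<tau>) \<Longrightarrow> b \<in> Basis \<Longrightarrow> 0 \<le> W \<tau> x \<bullet> b"
    and mean: "\<And>\<tau>. (\<integral>x. W \<tau> x \<partial>N \<tau>) = (\<integral>x. w x \<partial>M)"
    and weak: "\<And>f :: 'v \<Rightarrow> real. continuous_on UNIV f \<Longrightarrow> bounded (range f) \<Longrightarrow>
        ((\<lambda>\<tau>. \<integral>x. f (W \<tau> x) \<partial>N \<tau>) \<longlongrightarrow> (\<integral>x. f (w x) \<partial>M)) G"
    and "0 < \<epsilon>"
  shows "\<forall>\<^sub>F \<tau> in G. (\<integral>x. min (c \<bullet> w x) 0 \<partial>M) - \<epsilon> < (\<integral>x. min (c \<bullet> W \<tau> x) 0 \<partial>N \<tau>)"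
proof -
  interpret prob_space M by fact
  define A where "A = (\<Sum>b\<in>Basis. \<bar>c \<bullet> b\<bar> *\<^sub>R b)"
  define g where "g u = A \<bullet> u + min (c \<bullet> u) 0" for u
  \<comment> \<open>The outer maximum is inactive on the orthant; it keeps \<open>f m\<close> bounded on the whole space.\<close>
  define f where "f m u = max 0 (min (g u) (real m))" for m u
  have g_nn: "0 \<le> g u" if "\<And>b. b \<in> Basis \<Longrightarrow> 0 \<le> u \<bullet> b" for u
  proof -
    have "\<bar>c \<bullet> u\<bar> \<le> A \<bullet> u"
    proof -
      have "\<bar>c \<bullet> u\<bar> = \<bar>\<Sum>b\<in>Basis. (c \<bullet> b) * (u \<bullet> b)\<bar>" by (subst euclidean_inner) simp
      also have "\<dots> \<le> (\<Sum>b\<in>Basis. \<bar>c \<bullet> b\<bar> * (u \<bullet> b))"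
        using that by (intro order_trans[OF sum_abs] sum_mono) (simp add: abs_mult)
      also have "\<dots> = A \<bullet> u"
        by (simp add: A_def inner_sum_left) (simp add: inner_commute)
      finally show ?thesis .
    qed
    then show ?thesis by (auto simp: g_def min_def)
  qed
  have gw: "integrable M (\<lambda>x. g (w x))" "(\<integral>x. g (w x) \<partial>M) = A \<bullet> (\<integral>x. w x \<partial>M) + (\<integral>x. min (c \<bullet> w x) 0 \<partial>M)"
    using w by (simp_all add: g_def)
  have gW: "integrable (N \<tau>) (\<lambda>x. g (W \<tau> x))"
    "(\<integral>x. g (W \<tau> x) \<partial>N \<tau>) = A \<bullet> (\<integral>x. w x \<partial>M) + (\<integral>x. min (c \<bullet> W \<tau> x) 0 \<partial>N \<tau>)" for \<tau>
  proof -
    interpret N: prob_space "N \<tau>" by (rule N)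
    show "integrable (N \<tau>) (\<lambda>x. g (W \<tau> x))"
      "(\<integral>x. g (W \<tau> x) \<partial>N \<tau>) = A \<bullet> (\<integral>x. w x \<partial>M) + (\<integral>x. min (c \<bullet> W \<tau> x) 0 \<partial>N \<tau>)"
      using W[of \<tau>] mean[of \<tau>] by (simp_all add: g_def)
  qed
  have cont: "continuous_on UNIV (f m)" for m
    unfolding f_def g_def by (intro continuous_intros)
  have [measurable]: "w \<in> borel_measurable M" using w by auto
  have [measurable]: "g \<in> borel_measurable borel" "f m \<in> borel_measurable borel" for m
    unfolding f_def g_def by measurable
  have "(\<lambda>m. \<integral>x. f m (w x) \<partial>M) \<longlonglongrightarrow> (\<integral>x. g (w x) \<partial>M)"
  proof (rule integral_dominated_convergence[where w="\<lambda>x. norm (g (w x))"])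
    show "AE x in M. (\<lambda>m. f m (w x)) \<longlonglongrightarrow> g (w x)"
    proof (intro AE_I2 tendsto_eventually)
      fix x assume x: "x \<in> space M"
      have "\<forall>\<^sub>F m in sequentially. nat \<lceil>g (w x)\<rceil> \<le> m" by (rule eventually_ge_at_top)
      then show "\<forall>\<^sub>F m in sequentially. f m (w x) = g (w x)"
      proof eventually_elim
        case (elim m)
        have "0 \<le> g (w x)" by (rule g_nn[OF w_nn[OF x]])
        moreover have "g (w x) \<le> real m" using elim by linarith
        ultimately show ?case by (simp add: f_def)
      qed
    qed
    show "AE x in M. norm (f m (w x)) \<le> norm (g (w x))" for m
      by (auto simp: f_def)
  qed (use gw in auto)
  from order_tendstoD(1)[OF this, of "(\<integral>x. g (w x) \<partial>M) - \<epsilon>"] \<open>0 < \<epsilon>\<close>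
  obtain m where m: "(\<integral>x. g (w x) \<partial>M) - \<epsilon> < (\<integral>x. f m (w x) \<partial>M)"
    by (auto simp: eventually_sequentially)
  have "bounded (range (f m))"
    by (rule boundedI[of _ "real m"]) (auto simp: f_def)
  from order_tendstoD(1)[OF weak[OF cont this] m]
  show ?thesis
  proof eventually_elim
    case (elim \<tau>)
    interpret N: prob_space "N \<tau>" by (rule N)
    have [measurable]: "W \<tau> \<in> borel_measurable (N \<tau>)" using W[of \<tau>] by auto
    have "(\<integral>x. f m (W \<tau> x) \<partial>N \<tau>) \<le> (\<integral>x. g (W \<tau> x) \<partial>N \<tau>)"
    proof (rule integral_mono)
      show "integrable (N \<tau>) (\<lambda>x. f m (W \<tau> x))"
        by (rule N.integrable_const_bound[of _ "real m"]) (auto simp: f_def)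
      show "f m (W \<tau> x) \<le> g (W \<tau> x)" if "x \<in> space (N \<tau>)" for x
        using g_nn[of "W \<tau> x"] W_nn[OF that] by (auto simp: f_def)
    qed (rule gW)
    then show ?case using elim gw(2) gW(2)[of \<tau>] by linarith
  qed
qed

text \<open>Passing to a finer filter turns a cluster point into a limit. In this way all other limits along
the net remain available at the same time.\<close>

lemma cluster_subfilter:
  assumes "compact K" and "\<forall>\<^sub>F \<tau> in F. v \<tau> \<in> K" and "F \<noteq> bot"
  obtains z G where "G \<le> F" "G \<noteq> bot" "(v \<longlongrightarrow> z) G"
proof -
  obtain z where z: "inf (nhds z) (filtermap v F) \<noteq> bot"
    using assms(1)[unfolded compact_filter, rule_format, of "filtermap v F"] assms(2,3)
    by (auto simp: eventually_filtermap filtermap_bot_iff)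
  define G where "G = inf F (filtercomap v (nhds z))"
  have "G \<noteq> bot"
  proof
    assume "G = bot"
    then have "eventually (\<lambda>_. False) (inf F (filtercomap v (nhds z)))"
      by (simp add: G_def)
    then obtain P Q where P: "eventually P F" and Q: "eventually Q (nhds z)"
      and PQ: "\<And>x. P x \<Longrightarrow> Q (v x) \<Longrightarrow> False"
      unfolding eventually_inf eventually_filtercomap by blast
    have "eventually (\<lambda>y. \<not> Q y) (filtermap v F)"
      unfolding eventually_filtermap using P by (rule eventually_mono) (use PQ in blast)
    with Q have "eventually (\<lambda>_. False) (inf (nhds z) (filtermap v F))"
      unfolding eventually_inf by (intro exI[of _ Q] exI[of _ "\<lambda>y. \<not> Q y"]) simp
    with z show False by (simp add: trivial_limit_def)
  qed
  moreover have "(v \<longlongrightarrow> z) G"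
    unfolding G_def filterlim_iff_le_filtercomap by simp
  ultimately show ?thesis
    using that[of G z] by (simp add: G_def)
qed

text \<open>Each neighbourhood of \<open>z\<close> contains \<open>v n\<close> for arbitrarily large indices \<open>n = h \<tau>\<close>, so increasing
indices can be chosen one after another for a countable neighbourhood base.\<close>

lemma subsequence_of_net_limit:
  fixes v :: "nat \<Rightarrow> 'b :: metric_space"
  assumes G: "G \<noteq> bot" and h: "filterlim h at_top G" and v: "((\<lambda>\<tau>. v (h \<tau>)) \<longlongrightarrow> z) G"
  obtains r :: "nat \<Rightarrow> nat" where "strict_mono r" "(\<lambda>k. v (r k)) \<longlonglongrightarrow> z"
proof -
  have ex: "\<exists>n>N. dist (v n) z < \<epsilon>" if "0 < \<epsilon>" for N \<epsilon>
  proof -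
    have "\<forall>\<^sub>F \<tau> in G. N < h \<tau>" 
      using h unfolding filterlim_at_top by (auto dest: spec[of _ "Suc N"] simp: Suc_le_eq)
    moreover have "\<forall>\<^sub>F \<tau> in G. dist (v (h \<tau>)) z < \<epsilon>" using v that by (rule tendstoD)
    ultimately have "\<forall>\<^sub>F \<tau> in G. N < h \<tau> \<and> dist (v (h \<tau>)) z < \<epsilon>" by (rule eventually_conj)
    then show ?thesis using eventually_happens'[OF G] by blast
  qed
  have "\<exists>r. \<forall>k. dist (v (r k)) z < 1 / real (Suc k) \<and> r k < r (Suc k)"
  proof (rule dependent_nat_choice)
    show "\<exists>n. dist (v n) z < 1 / real (Suc 0)"
      using ex[of 1 0] by auto
    show "\<exists>n. dist (v n) z < 1 / real (Suc (Suc k)) \<and> l < n" for l k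
      using ex[of "1 / real (Suc (Suc k))" l] by auto
  qed
  then obtain r where r: "\<And>k. dist (v (r k)) z < 1 / real (Suc k)" "\<And>k. r k < r (Suc k)"
    by blast
  have "(\<lambda>k. v (r k)) \<longlonglongrightarrow> z"
    by (subst tendsto_dist_iff, rule tendsto_sandwich[OF _ _ tendsto_const LIMSEQ_Suc[OF lim_1_over_n]])
       (auto intro!: always_eventually less_imp_le[OF r(1)] simp del: of_nat_Suc)
  then show ?thesis using that r(2) strict_mono_Suc_iff by blast
qed

text \<open>The abstract form of the theorem. For a cluster point \<open>z j\<close> of the moment vectors, any test \<open>\<psi>\<close> satisfies
\<open>c \<bullet> E(\<psi> W) \<ge> E(min (c \<bullet> W) 0)\<close>, and the weak limit of the right-hand side is at least
\<open>E(min (c \<bullet> w) 0)\<close>; so \<open>z j\<close> is attainable.\<close>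

lemma limits_of_tests_attained:
  fixes w :: "'a \<Rightarrow> 'v :: euclidean_space" and W :: "nat \<Rightarrow> 'b \<Rightarrow> 'v"
    and \<psi> :: "nat \<Rightarrow> nat \<Rightarrow> 'b \<Rightarrow> real"
  assumes M: "prob_space M" and w: "integrable M w"
    and w_nn: "\<And>x b. x \<in> space M \<Longrightarrow> b \<in> Basis \<Longrightarrow> 0 \<le> w x \<bullet> b"
    and N: "\<And>n. prob_space (N n)" and W: "\<And>n. integrable (N n) (W n)"
    and W_nn: "\<And>n x b. x \<in> space (N n) \<Longrightarrow> b \<in> Basis \<Longrightarrow> 0 \<le> W n x \<bullet> b"
    and mean: "\<And>n. (\<integral>x. W n x \<partial>N n) = (\<integral>x. w x \<partial>M)"
    and F: "F \<noteq> bot" and h: "filterlim h at_top F"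
    and weak: "\<And>f :: 'v \<Rightarrow> real. continuous_on UNIV f \<Longrightarrow> bounded (range f) \<Longrightarrow>
        ((\<lambda>\<tau>. \<integral>x. f (W (h \<tau>) x) \<partial>N (h \<tau>)) \<longlongrightarrow> (\<integral>x. f (w x) \<partial>M)) F"
    and \<psi>: "\<And>n j. j \<in> J \<Longrightarrow> \<psi> n j \<in> tests_on (N n)"
  obtains r :: "nat \<Rightarrow> nat" and \<phi> where "strict_mono r" and "\<And>j. j \<in> J \<Longrightarrow> \<phi> j \<in> tests_on M"
    and "\<And>j. j \<in> J \<Longrightarrow>
      (\<lambda>k. \<integral>x. \<psi> (r k) j x *\<^sub>R W (r k) x \<partial>N (r k)) \<longlonglongrightarrow> (\<integral>x. \<phi> j x *\<^sub>R w x \<partial>M)"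
proof -
  \<comment> \<open>All claims share one subsequence: the sequence lives in the metrizable space of functions
    \<open>nat \<Rightarrow> 'v\<close>, with value \<open>0\<close> off \<open>J\<close> to remain in the compact product.\<close>
  define v where "v n j = (if j \<in> J then \<integral>x. \<psi> n j x *\<^sub>R W n x \<partial>N n else 0)" for n j
  define R where "R = (\<integral>x. w x \<partial>M) \<bullet> (\<Sum>b\<in>Basis. b)"
  have R_eq: "(\<integral>x. norm (W n x) \<partial>N n) \<le> R" for n
  proof -
    have "(\<integral>x. norm (W n x) \<partial>N n) \<le> (\<integral>x. W n x \<bullet> (\<Sum>b\<in>Basis. b) \<partial>N n)"
    proof (rule integral_mono)
      fix x assume "x \<in> space (N n)"
      then have "(\<Sum>b\<in>Basis. \<bar>W n x \<bullet> b\<bar>) = W n x \<bullet> (\<Sum>b\<in>Basis. b)"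
        using W_nn by (simp add: inner_sum_right)
      then show "norm (W n x) \<le> W n x \<bullet> (\<Sum>b\<in>Basis. b)" using norm_le_l1[of "W n x"] by simp
    qed (use W[of n] in auto)
    also have "\<dots> = R" unfolding R_def mean[of n, symmetric] using W[of n] by simp
    finally show ?thesis .
  qed
  have v_bound: "v n j \<in> cball 0 \<bar>R\<bar>" for n j
  proof (cases "j \<in> J")
    case True
    have "norm (v n j) \<le> (\<integral>x. norm (\<psi> n j x *\<^sub>R W n x) \<partial>N n)"
      using True by (simp add: v_def integral_norm_bound del: norm_scaleR)
    also have "\<dots> \<le> (\<integral>x. norm (W n x) \<partial>N n)"
      using integrable_test_scaleR[OF \<psi>[OF True] W[of n]] W[of n] tests_onD(2,3)[OF \<psi>[OF True]]
      by (intro integral_mono) (auto intro!: mult_left_le_one_le simp del: integrable_norm_iff norm_scaleR, simp add: mult_left_le_one_le)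
    finally show ?thesis using R_eq[of n] by simp
  qed (simp add: v_def)
  have "compact (PiE UNIV (\<lambda>_::nat. cball 0 \<bar>R\<bar> :: 'v set))"
    using compactin_PiE[of "\<lambda>_. euclidean" UNIV "\<lambda>_. cball 0 \<bar>R\<bar> :: 'v set"]
    by (simp add: euclidean_product_topology)
  then obtain z G where G: "G \<le> F" "G \<noteq> bot" and z: "((\<lambda>\<tau>. v (h \<tau>)) \<longlongrightarrow> z) G"
    by (rule cluster_subfilter[of _ "\<lambda>\<tau>. v (h \<tau>)" F]) (use v_bound F in \<open>auto simp: PiE_def\<close>)
  have coord: "((\<lambda>\<tau>. u \<tau> j) \<longlongrightarrow> y j) H" if "(u \<longlongrightarrow> y) H" 
    for y j and H :: "'x filter" and u :: "'x \<Rightarrow> nat \<Rightarrow> 'v"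
    using continuous_on_tendsto_compose[OF continuous_on_product_coordinates that] by simp
  have "z j \<in> moment_set M w" if j: "j \<in> J" for j
  proof (rule moment_setI_lower_bound[OF M w])
    fix c :: 'v
    let ?B = "\<integral>x. min (c \<bullet> w x) 0 \<partial>M"
    have lim: "((\<lambda>\<tau>. c \<bullet> v (h \<tau>) j) \<longlongrightarrow> c \<bullet> z j) G" by (intro tendsto_intros coord z)
    have "?B - \<epsilon> \<le> c \<bullet> z j" if \<epsilon>: "0 < \<epsilon>" for \<epsilon>
    proof (rule tendsto_lowerbound[OF lim _ G(2)])
      have "\<forall>\<^sub>F \<tau> in F. ?B - \<epsilon> < (\<integral>x. min (c \<bullet> W (h \<tau>) x) 0 \<partial>N (h \<tau>))"
        using weak_limit_lower_bound[OF M w w_nn, of "\<lambda>\<tau>. N (h \<tau>)" "\<lambda>\<tau>. W (h \<tau>)" F \<epsilon> c]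
          N W W_nn mean weak \<epsilon> by blast
      then have "\<forall>\<^sub>F \<tau> in G. ?B - \<epsilon> < (\<integral>x. min (c \<bullet> W (h \<tau>) x) 0 \<partial>N (h \<tau>))"
        using G(1) by (simp add: filter_leD)
      then show "\<forall>\<^sub>F \<tau> in G. ?B - \<epsilon> \<le> c \<bullet> v (h \<tau>) j"
      proof eventually_elim
        case (elim \<tau>)
        let ?n = "h \<tau>"
        interpret N: prob_space "N ?n" by (rule N)
        note i = integrable_test_scaleR[OF \<psi>[OF j] W[of ?n]]
        have "(\<integral>x. min (c \<bullet> W ?n x) 0 \<partial>N ?n) \<le> (\<integral>x. c \<bullet> (\<psi> ?n j x *\<^sub>R W ?n x) \<partial>N ?n)"
        proof (rule integral_mono)
          show "integrable (N ?n) (\<lambda>x. c \<bullet> (\<psi> ?n j x *\<^sub>R W ?n x))"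
            by (intro integrable_inner_right i)
          fix x assume "x \<in> space (N ?n)"
          then have p: "0 \<le> \<psi> ?n j x" "\<psi> ?n j x \<le> 1" using tests_onD(2,3)[OF \<psi>[OF j]] by auto
          show "min (c \<bullet> W ?n x) 0 \<le> c \<bullet> (\<psi> ?n j x *\<^sub>R W ?n x)"
            using mult_left_le_one_le[of "- (c \<bullet> W ?n x)" "\<psi> ?n j x"] p
            by (cases "0 \<le> c \<bullet> W ?n x") (auto simp: min_def)
        qed (use W[of ?n] in simp_all)
        also have "\<dots> = c \<bullet> v ?n j" using j by (simp add: v_def del: inner_scaleR_right) (simp add: integral_inner_right i del: inner_scaleR_right)
        finally show ?case using elim by simp
      qed
    qed
    then show "?B \<le> c \<bullet> z j" by (meson field_le_epsilon le_diff_eq diff_le_eq)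
  qed
  then have "\<forall>j. \<exists>\<phi>. j \<in> J \<longrightarrow> \<phi> \<in> tests_on M \<and> z j = (\<integral>x. \<phi> x *\<^sub>R w x \<partial>M)"
    using moment_setE by metis
  then obtain \<phi> where \<phi>: "\<And>j. j \<in> J \<Longrightarrow> \<phi> j \<in> tests_on M \<and> z j = (\<integral>x. \<phi> j x *\<^sub>R w x \<partial>M)"
    by metis
  have "filterlim h at_top G" using h G(1) by (rule filterlim_mono[OF _ order_refl])
  then obtain r :: "nat \<Rightarrow> nat" where r: "strict_mono r" "(\<lambda>k. v (r k)) \<longlonglongrightarrow> z"
    using subsequence_of_net_limit[OF G(2) _ z] by blast
  show ?thesis
  proof (rule that[OF r(1)])
    show "\<phi> j \<in> tests_on M" if "j \<in> J" for j using \<phi> that by blast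
    show "(\<lambda>k. \<integral>x. \<psi> (r k) j x *\<^sub>R W (r k) x \<partial>N (r k)) \<longlonglongrightarrow> (\<integral>x. \<phi> j x *\<^sub>R w x \<partial>M)" if "j \<in> J" for j
      using coord[OF r(2), of j] \<phi>[OF that] that by (simp add: v_def)
  qed
qed

text \<open>That the density integrates to one rules out an escape of mass, both in the markets
and in the limit experiment.\<close>

lemma prob_density_integral_1:
  assumes f: "f \<in> borel_measurable M" and nn: "\<And>x. x \<in> space M \<Longrightarrow> 0 \<le> f x"
    and prob: "prob_space (density M (\<lambda>x. ennreal (f x)))"
  shows "integrable M f" "(\<integral>x. f x \<partial>M) = 1"
proof -
  have "(\<integral>\<^sup>+x. ennreal (f x) \<partial>M) = emeasure (density M (\<lambda>x. ennreal (f x))) (space M)"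
    using f by (subst emeasure_density) (auto intro!: nn_integral_cong)
  also have "\<dots> = 1" using prob_space.emeasure_space_1[OF prob] by simp
  finally have 1: "(\<integral>\<^sup>+x. ennreal (f x) \<partial>M) = ennreal 1" by simp
  have "has_bochner_integral M f 1"
    using f nn 1 by (intro has_bochner_integral_nn_integral) auto
  then show "integrable M f" "(\<integral>x. f x \<partial>M) = 1"
    by (auto simp: has_bochner_integral_iff)
qed

section \<open>Path space\<close>

lemma space_path_space: "space (path_space I) = (\<Pi>\<^sub>E t\<in>I. orthant)"
  by (simp add: path_space_def space_PiM space_restrict_space)

lemma path_space_nonneg: "\<omega> \<in> space (path_space I) \<Longrightarrow> t \<in> I \<Longrightarrow> 0 \<le> \<omega> t $ i"
  by (auto simp: space_path_space PiE_def Pi_def orthant_def)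

lemma measurable_path_coordinate:
  assumes "t \<in> I"
  shows "(\<lambda>\<omega>. \<omega> t :: real ^ 'd) \<in> path_space I \<rightarrow>\<^sub>M restrict_space borel orthant"
  unfolding path_space_def using assms by (rule measurable_component_singleton)

lemma measurable_path_coordinate_borel:
  assumes "t \<in> I"
  shows "(\<lambda>\<omega>. \<omega> t :: real ^ 'd) \<in> borel_measurable (path_space I)"
  using measurable_path_coordinate[OF assms, where ?'d='d] by (simp add: measurable_restrict_space2_iff)

lemma space_path_filtration: "space (path_filtration I t) = space (path_space I)"
  unfolding path_filtration_def by (rule space_measure_of) auto

lemma sets_path_filtration: "sets (path_filtration I t) = sigma_sets (space (path_space I))
     {(\<lambda>\<omega>. \<omega> s :: real ^ 'd) -` A \<inter> space (path_space I) |s A.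
        s \<in> I \<inter> {0..t} \<and> A \<in> sets (restrict_space borel orthant)}"
  unfolding path_filtration_def by (rule sets_measure_of) auto

lemma subalgebra_path_filtration:
  assumes "sets \<nu> = sets (path_space I)"
  shows "subalgebra \<nu> (path_filtration I t)"
  unfolding subalgebra_def
proof
  show "space (path_filtration I t) = space \<nu>"
    using sets_eq_imp_space_eq[OF assms] by (simp add: space_path_filtration)
  have "sigma_sets (space (path_space I))
     {(\<lambda>\<omega>. \<omega> s) -` A \<inter> space (path_space I) |s A.
        s \<in> I \<inter> {0..t} \<and> A \<in> sets (restrict_space borel orthant)} \<subseteq> sets (path_space I)"
    by (rule sets.sigma_sets_subset) (auto intro!: measurable_sets[OF measurable_path_coordinate])
  then show "sets (path_filtration I t) \<subseteq> sets \<nu>"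
    by (simp add: sets_path_filtration assms)
qed

lemma borel_measurable_path_filtration_coordinate:
  assumes "t \<in> I" "0 \<le> t"
  shows "(\<lambda>\<omega> :: real \<Rightarrow> real ^ 'd. \<omega> t $ i) \<in> borel_measurable (path_filtration I t)"
proof -
  have "(\<lambda>\<omega>. \<omega> t :: real ^ 'd) \<in> path_filtration I t \<rightarrow>\<^sub>M restrict_space borel orthant"
  proof (rule measurableI)
    show "\<omega> t \<in> space (restrict_space borel orthant)" if "\<omega> \<in> space (path_filtration I t)" for \<omega> :: "real \<Rightarrow> real ^ 'd"
      using that assms by (auto simp: space_path_filtration space_path_space space_restrict_space)
    show "(\<lambda>\<omega>. \<omega> t) -` A \<inter> space (path_filtration I t) \<in> sets (path_filtration I t)"
      if "A \<in> sets (restrict_space borel orthant)" for A :: "(real ^ 'd) set"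
      unfolding sets_path_filtration space_path_filtration
      using that assms by (intro sigma_sets.Basic) auto
  qed
  then have "(\<lambda>\<omega>. \<omega> t :: real ^ 'd) \<in> borel_measurable (path_filtration I t)"
    by (simp add: measurable_restrict_space2_iff)
  then show ?thesis
    by (rule measurable_compose) (intro borel_measurable_continuous_onI continuous_intros)
qed

text \<open>All times are at most \<open>T\<close>, so the filtration has reached the full product \<open>\<sigma>\<close>-field at \<open>T\<close>. This
makes \<open>\<pi>\<^sub>T\<close> the vector of global densities.\<close>

lemma restr_to_subalg_path_filtration_final:
  fixes \<nu> :: "(real \<Rightarrow> real ^ 'd) measure"
  assumes sets: "sets \<nu> = sets (path_space I)" and "I \<subseteq> {0..T}"
  shows "restr_to_subalg \<nu> (path_filtration I T) = \<nu>"
proof -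
  have gen: "sets (path_filtration I T) = sets (path_space I :: (real \<Rightarrow> real ^ 'd) measure)"
  proof -
    have "{(\<lambda>\<omega>. \<omega> s :: real ^ 'd) -` A \<inter> space (path_space I) |s A.
        s \<in> I \<inter> {0..T} \<and> A \<in> sets (restrict_space borel orthant)}
      = {{\<omega> \<in> \<Pi>\<^sub>E t\<in>I. space (restrict_space borel orthant). \<omega> s \<in> A} |s A.
        s \<in> I \<and> A \<in> sets (restrict_space borel orthant)}"
      using assms(2) by (auto simp: space_path_space space_restrict_space) (auto intro!: exI)+
    then show ?thesis
      unfolding sets_path_filtration path_space_def sets_PiM_single
      by (simp add: space_PiM path_space_def)
  qed
  note sub = subalgebra_path_filtration[OF sets, of T]
  show ?thesis
    using emeasure_restr_to_subalg[OF sub] gen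
    by (intro measure_eqI) (auto simp: sets_restr_to_subalg[OF sub] sets)
qed

lemma standard_experiment_density:
  assumes E: "standard_experiment I \<nu> \<nu>s" and I: "I \<subseteq> {0..T}" "T \<in> I"
  shows "\<nu>s i = density \<nu> (\<lambda>\<omega>. ennreal (\<omega> T $ i))"
  using E I restr_to_subalg_path_filtration_final[OF _ I(1), of \<nu>]
    restr_to_subalg_path_filtration_final[OF _ I(1), of "\<nu>s i"]
  unfolding standard_experiment_def by metis

lemma coordinate_is_RN_deriv:
  assumes E: "standard_experiment I \<nu> \<nu>s" and t: "t \<in> I" "0 \<le> t"
  shows "AE \<omega> in \<nu>. enn2real (RN_deriv (restr_to_subalg \<nu> (path_filtration I t))
      (restr_to_subalg (\<nu>s i) (path_filtration I t)) \<omega>) = \<omega> t $ i"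
proof -
  let ?R = "restr_to_subalg \<nu> (path_filtration I t)"
  have \<nu>: "prob_space \<nu>" "sets \<nu> = sets (path_space I)"
    and dens: "restr_to_subalg (\<nu>s i) (path_filtration I t) = density ?R (\<lambda>\<omega>. ennreal (\<omega> t $ i))"
    using E t by (auto simp: standard_experiment_def)
  note sub = subalgebra_path_filtration[OF \<nu>(2), of t]
  interpret R: prob_space ?R
    by (rule prob_space_restr_to_subalg[OF sub \<nu>(1)])
  have "AE \<omega> in ?R. ennreal (\<omega> t $ i) = RN_deriv ?R (restr_to_subalg (\<nu>s i) (path_filtration I t)) \<omega>"
  proof (rule R.RN_deriv_unique[OF _ dens[symmetric]])
    show "(\<lambda>\<omega>. ennreal (\<omega> t $ i)) \<in> borel_measurable ?R"
      by (intro measurable_compose[OF _ measurable_ennreal])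
         (simp add: measurable_cong_sets[OF sets_restr_to_subalg[OF sub] refl]
            borel_measurable_path_filtration_coordinate[OF t])
  qed
  from AE_restr_to_subalg[OF sub this] show ?thesis
    using AE_space
  proof eventually_elim
    case (elim \<omega>)
    have "\<omega> \<in> space (path_space I)" using elim(2) sets_eq_imp_space_eq[OF \<nu>(2)] by simp
    from path_space_nonneg[OF this t(1)] show ?case by (simp flip: elim(1))
  qed
qed

section \<open>Payoffs as inner products\<close>

lemma Basis_real_vec_cases:
  fixes b :: "real \<times> (real ^ 'd)"
  assumes "b \<in> Basis"
  obtains "b = (1, 0)" | i where "b = (0, axis i 1)"
  using assms by (auto simp: Basis_prod_def Basis_vec_def)

lemma inner_cash_vec: "((k, c) :: real \<times> (real ^ 'd)) \<bullet> (x, y) = k * x + (\<Sum>i\<in>UNIV. c $ i * y $ i)"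
  by (simp add: inner_vec_def)

lemma Basis_inner_cash_vec_nonneg:
  fixes y :: "real ^ 'd"
  assumes "b \<in> Basis" "\<And>i. 0 \<le> y $ i"
  shows "0 \<le> (1 :: real, y) \<bullet> b"
  using assms(1) by (rule Basis_real_vec_cases) (simp_all add: inner_axis assms(2))

lemma integral_cash_vec:
  fixes y :: "'a \<Rightarrow> real ^ 'd"
  assumes M: "prob_space M" and "\<And>i. integrable M (\<lambda>x. y x $ i)" "\<And>i. (\<integral>x. y x $ i \<partial>M) = 1"
  shows "integrable M (\<lambda>x. (1 :: real, y x))" "(\<integral>x. (1 :: real, y x) \<partial>M) = (\<Sum>b\<in>Basis. b)"
proof -
  interpret prob_space M by fact
  have b: "integrable M (\<lambda>x. (1 :: real, y x) \<bullet> b)" "(\<integral>x. (1 :: real, y x) \<bullet> b \<partial>M) = 1"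
    if "b \<in> Basis" for b :: "real \<times> (real ^ 'd)"
    using that by (cases rule: Basis_real_vec_cases; simp add: inner_axis assms prob_space)+
  have eq: "(\<lambda>x. (1 :: real, y x)) = (\<lambda>x. \<Sum>b\<in>Basis. ((1, y x) \<bullet> b) *\<^sub>R b)"
    by (simp only: euclidean_representation)
  show "integrable M (\<lambda>x. (1 :: real, y x))"
    by (subst eq) (intro Bochner_Integration.integrable_sum integrable_scaleR_left b)
  show "(\<integral>x. (1 :: real, y x) \<partial>M) = (\<Sum>b\<in>Basis. b)"
    by (subst eq) (simp add: b Bochner_Integration.integral_sum)
qed

lemma bond_pos: "0 < bond \<rho> t"
  by (simp add: bond_def)

lemma bond_0: "bond \<rho> 0 = 1"
proof -
  have "(LINT u:{0..0}|lebesgue. \<rho> u) = 0"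
    unfolding set_lebesgue_integral_def
    by (rule integral_eq_zero_AE, rule AE_I'[of "{0}"]) (auto split: split_indicator_asm)
  then show ?thesis by (simp add: bond_def)
qed

text \<open>The first component belongs to the bond, with the discounted strike as its (negative) weight.\<close>

definition claim_coeff :: "(real \<Rightarrow> real) \<Rightarrow> real \<Rightarrow> real ^ 'd \<Rightarrow> real ^ 'd \<Rightarrow> real \<Rightarrow> real \<times> (real ^ 'd)" where
  "claim_coeff \<rho> T s a K = (- K * inverse (bond \<rho> T), \<chi> i. a $ i * s $ i)"

text \<open>Used in the market with \<open>y\<close> the relative terminal prices, and in the limit experiment with \<open>y = \<omega> T\<close>.\<close>

lemma discounted_payoff_eq_inner:
  assumes "\<And>i. S T \<omega> $ i = bond \<rho> T * (s $ i * y $ i)"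
  shows "inverse (bond \<rho> T) * payoff T I \<rho> s S a K \<phi> \<omega>
    = claim_coeff \<rho> T s a K \<bullet> (\<phi> (normalized_prices I \<rho> s S \<omega>) *\<^sub>R (1, y))"
proof -
  let ?p = "\<phi> (normalized_prices I \<rho> s S \<omega>)"
  have "inverse (bond \<rho> T) * ((\<Sum>i\<in>UNIV. a $ i * S T \<omega> $ i) - K)
      = (\<Sum>i\<in>UNIV. a $ i * s $ i * y $ i) - K * inverse (bond \<rho> T)"
    using bond_pos[of \<rho> T]
    by (simp add: assms right_diff_distrib sum_distrib_left) (simp add: field_simps)
  then have "inverse (bond \<rho> T) * payoff T I \<rho> s S a K \<phi> \<omega>
      = ?p * ((\<Sum>i\<in>UNIV. a $ i * s $ i * y $ i) - K * inverse (bond \<rho> T))"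
    unfolding payoff_def by (metis mult.assoc mult.commute)
  also have "\<dots> = ?p * (claim_coeff \<rho> T s a K \<bullet> (1, y))"
    by (simp add: claim_coeff_def inner_cash_vec del: inner_Pair)
  finally show ?thesis by (simp only: inner_scaleR_right)
qed

lemma measurable_into_path_space:
  fixes f :: "real \<Rightarrow> 'w \<Rightarrow> real ^ 'd"
  assumes "\<And>t i. t \<in> I \<Longrightarrow> (\<lambda>\<omega>. f t \<omega> $ i) \<in> borel_measurable M"
    and "\<And>t \<omega> i. t \<in> I \<Longrightarrow> \<omega> \<in> space M \<Longrightarrow> 0 \<le> f t \<omega> $ i"
  shows "(\<lambda>\<omega>. \<lambda>t\<in>I. f t \<omega>) \<in> M \<rightarrow>\<^sub>M path_space I"
  unfolding path_space_def
proof (rule measurable_restrict)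
  fix t assume t: "t \<in> I"
  have "f t \<in> borel_measurable M"
    using assms(1)[OF t] by (subst borel_measurable_euclidean_space) (auto simp: Basis_vec_def inner_axis)
  then show "(\<lambda>\<omega>. f t \<omega>) \<in> M \<rightarrow>\<^sub>M restrict_space borel orthant"
    using assms(2)[OF t] by (simp add: measurable_restrict_space2_iff orthant_def Pi_def)
qed

lemma integral_marginal_coordinate:
  fixes f :: "real ^ 'd \<Rightarrow> real"
  assumes f: "continuous_on UNIV f" and T: "T \<in> I" and sets: "sets M = sets (path_space I)"
  shows "(\<integral>\<omega>. f (\<omega> T) \<partial>marginal {T} M) = (\<integral>\<omega>. f (\<omega> T) \<partial>M)"
proof -
  have "(\<lambda>\<omega>. restrict \<omega> {T}) \<in> M \<rightarrow>\<^sub>M (path_space {T} :: (real \<Rightarrow> real ^ 'd) measure)"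
    unfolding measurable_cong_sets[OF sets refl] path_space_def
    using T by (intro measurable_restrict_subset) auto
  moreover have "(\<lambda>\<omega>. f (\<omega> T)) \<in> borel_measurable (path_space {T})"
    by (intro measurable_compose[OF measurable_path_coordinate_borel borel_measurable_continuous_onI[OF f]]) simp
  ultimately show ?thesis
    unfolding marginal_def by (subst integral_distr) auto
qed

text \<open>The payoff factor and the densities are functions of the terminal prices, so the limit argument runs
on the marginal at time \<open>T\<close>.\<close>

lemma fidi_conv_along_coordinate:
  fixes f :: "real ^ 'd \<Rightarrow> real"
  assumes conv: "fidi_conv_along I M \<nu> G" and T: "T \<in> I"
    and sets: "\<And>\<tau>. sets (M \<tau>) = sets (path_space I)" "sets \<nu> = sets (path_space I)"
    and f: "continuous_on UNIV f" "bounded (range f)"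
  shows "((\<lambda>\<tau>. \<integral>\<omega>. f (\<omega> T) \<partial>M \<tau>) \<longlongrightarrow> (\<integral>\<omega>. f (\<omega> T) \<partial>\<nu>)) G"
proof -
  let ?X = "product_topology (\<lambda>_. top_of_set (orthant :: (real ^ 'd) set)) {T}"
  have "continuous_map ?X (top_of_set orthant) (\<lambda>\<omega>. \<omega> T)"
    by (rule continuous_map_product_projection) simp
  moreover have "continuous_map (top_of_set orthant) euclideanreal f"
    using f(1) by (auto intro: continuous_on_subset)
  ultimately have "continuous_map ?X euclideanreal (\<lambda>\<omega>. f (\<omega> T))"
    using continuous_map_compose[of ?X _ "\<lambda>\<omega>. \<omega> T" _ f] by (simp add: o_def)
  moreover have "bounded ((\<lambda>\<omega>. f (\<omega> T)) ` topspace ?X)"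
    by (rule bounded_subset[OF f(2)]) auto
  ultimately have "((\<lambda>\<tau>. \<integral>\<omega>. f (\<omega> T) \<partial>marginal {T} (M \<tau>)) \<longlongrightarrow> (\<integral>\<omega>. f (\<omega> T) \<partial>marginal {T} \<nu>)) G"
    using conv T unfolding fidi_conv_along_def weak_conv_along_def by blast
  then show ?thesis
    by (simp only: integral_marginal_coordinate[OF f(1) T sets(1)] integral_marginal_coordinate[OF f(1) T sets(2)])
qed

section \<open>Prices and moments in one market\<close>

context financial_experiment
begin

lemma space_Q: "space Q = space P"
  by (rule sets_eq_imp_space_eq) (rule Q_sets)

lemma prices_measurable:
  assumes "t \<in> I"
  shows "(\<lambda>\<omega>. X t \<omega> $ i) \<in> borel_measurable Q"
  using measurable_from_subalg[OF filtration_subalgebra[OF assms] X_adapted[OF assms]]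
  by (simp add: measurable_cong_sets[OF Q_sets refl])

lemma relative_prices_measurable:
  assumes "0 \<in> I"
  shows "relative_prices I X \<in> Q \<rightarrow>\<^sub>M path_space I"
proof -
  have "(\<lambda>\<omega>. \<lambda>t\<in>I. \<chi> i. X t \<omega> $ i / X 0 \<omega> $ i) \<in> Q \<rightarrow>\<^sub>M path_space I"
    using assms by (intro measurable_into_path_space)
      (auto intro!: borel_measurable_divide prices_measurable divide_nonneg_nonneg less_imp_le[OF X_pos] simp: space_Q)
  then show ?thesis by (simp add: relative_prices_def[abs_def])
qed

lemma normalized_prices_measurable:
  assumes "\<And>i. 0 < s $ i"
  shows "normalized_prices I \<rho> s (price \<rho> X) \<in> Q \<rightarrow>\<^sub>M path_space I"
proof -
  have "(\<lambda>\<omega>. \<lambda>t\<in>I. \<chi> i. price \<rho> X t \<omega> $ i / (s $ i * bond \<rho> t)) \<in> Q \<rightarrow>\<^sub>M path_space I"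
    unfolding price_def by (intro measurable_into_path_space)
      (auto intro!: borel_measurable_divide borel_measurable_times prices_measurable divide_nonneg_nonneg
        mult_nonneg_nonneg less_imp_le[OF X_pos] less_imp_le[OF bond_pos] less_imp_le[OF assms]
        simp: space_Q less_imp_neq[OF bond_pos, symmetric])
  then show ?thesis by (simp add: normalized_prices_def[abs_def])
qed

lemma relative_prices_mean:
  assumes "0 \<in> I" "T \<in> I"
  shows "integrable Q (\<lambda>\<omega>. relative_prices I X \<omega> T $ i)" "(\<integral>\<omega>. relative_prices I X \<omega> T $ i \<partial>Q) = 1"
proof -
  have m: "(\<lambda>\<omega>. X T \<omega> $ i / X 0 \<omega> $ i) \<in> borel_measurable Q"
    by (intro borel_measurable_divide prices_measurable assms)
  have nn: "0 \<le> X T \<omega> $ i / X 0 \<omega> $ i" if "\<omega> \<in> space Q" for \<omega>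
    using that X_pos[of _ \<omega> i] assms by (auto simp: space_Q less_imp_le)
  have "prob_space (density Q (\<lambda>\<omega>. ennreal (X T \<omega> $ i / X 0 \<omega> $ i)))"
    using Qs_prob[of i] by (simp add: Qs_density)
  from prob_density_integral_1[OF m nn this] assms
  show "integrable Q (\<lambda>\<omega>. relative_prices I X \<omega> T $ i)" "(\<integral>\<omega>. relative_prices I X \<omega> T $ i \<partial>Q) = 1"
    by (simp_all add: relative_prices_def)
qed

lemma option_price_as_moments:
  fixes \<rho> and \<psi> :: "nat \<Rightarrow> (real \<Rightarrow> real ^ 'd) \<Rightarrow> real"
  assumes I: "0 \<in> I" "T \<in> I"
    and s: "\<And>i. 0 < s $ i" "\<And>i. AE \<omega> in P. price \<rho> X 0 \<omega> $ i = s $ i"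
    and \<psi>: "\<And>j. j \<in> J \<Longrightarrow> \<psi> j \<in> tests I"
  shows "option_price \<rho> T Q (\<lambda>\<omega>. \<Sum>j\<in>J. payoff T I \<rho> s (price \<rho> X) (a j) (K j) (\<psi> j) \<omega>)
    = (\<Sum>j\<in>J. claim_coeff \<rho> T s (a j) (K j) \<bullet>
        (\<integral>\<omega>. \<psi> j (normalized_prices I \<rho> s (price \<rho> X) \<omega>) *\<^sub>R (1, relative_prices I X \<omega> T) \<partial>Q))"
proof -
  let ?v = "\<lambda>j \<omega>. \<psi> j (normalized_prices I \<rho> s (price \<rho> X) \<omega>) *\<^sub>R (1 :: real, relative_prices I X \<omega> T)"
  have v: "integrable Q (?v j)" if "j \<in> J" for j
  proof (rule integrable_test_scaleR)
    show "(\<lambda>\<omega>. \<psi> j (normalized_prices I \<rho> s (price \<rho> X) \<omega>)) \<in> tests_on Q"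
      using measurable_compose[OF normalized_prices_measurable[OF s(1)]] \<psi>[OF that] unfolding tests_def by blast
    show "integrable Q (\<lambda>\<omega>. (1 :: real, relative_prices I X \<omega> T))"
      by (intro integral_cash_vec Q_prob relative_prices_mean I)
  qed
  \<comment> \<open>The initial prices are deterministic only almost surely, so the relative and the normalized
    terminal prices agree up to a null set; the test itself keeps its original argument.\<close>
  have "AE \<omega> in Q. \<forall>i. X 0 \<omega> $ i = s $ i"
    using s(2) absolutely_continuous_AE[OF Q_sets Q_equivalent(1)] by (simp add: AE_all_countable price_def bond_0)
  then have ae: "AE \<omega> in Q. inverse (bond \<rho> T) * (\<Sum>j\<in>J. payoff T I \<rho> s (price \<rho> X) (a j) (K j) (\<psi> j) \<omega>)
      = (\<Sum>j\<in>J. claim_coeff \<rho> T s (a j) (K j) \<bullet> ?v j \<omega>)"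
  proof eventually_elim
    case (elim \<omega>)
    have "price \<rho> X T \<omega> $ i = bond \<rho> T * (s $ i * relative_prices I X \<omega> T $ i)" for i
      using elim s(1)[of i] I by (simp add: price_def relative_prices_def)
    then have "inverse (bond \<rho> T) * payoff T I \<rho> s (price \<rho> X) (a j) (K j) (\<psi> j) \<omega>
        = claim_coeff \<rho> T s (a j) (K j) \<bullet> ?v j \<omega>" for j
      by (rule discounted_payoff_eq_inner)
    then show ?case
      by (simp only: sum_distrib_left)
  qed
  have vm: "integrable Q (\<lambda>\<omega>. claim_coeff \<rho> T s (a j) (K j) \<bullet> ?v j \<omega>)" if "j \<in> J" for j
    by (intro integrable_inner_right v that)
  have pm: "(\<lambda>\<omega>. payoff T I \<rho> s (price \<rho> X) (a j) (K j) (\<psi> j) \<omega>) \<in> borel_measurable Q" if "j \<in> J" for j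
  proof -
    have "(\<lambda>\<omega>. \<psi> j (normalized_prices I \<rho> s (price \<rho> X) \<omega>)) \<in> borel_measurable Q"
      using measurable_compose[OF normalized_prices_measurable[OF s(1)]] \<psi>[OF that]
      unfolding tests_def measurable_restrict_space2_iff by blast
    then show ?thesis unfolding payoff_def price_def
      by (auto intro!: borel_measurable_times borel_measurable_sum borel_measurable_diff prices_measurable I)
  qed
  have "option_price \<rho> T Q (\<lambda>\<omega>. \<Sum>j\<in>J. payoff T I \<rho> s (price \<rho> X) (a j) (K j) (\<psi> j) \<omega>)
      = (\<integral>\<omega>. (\<Sum>j\<in>J. claim_coeff \<rho> T s (a j) (K j) \<bullet> ?v j \<omega>) \<partial>Q)"
    unfolding option_price_def
    by (intro integral_cong_AE ae borel_measurable_times borel_measurable_const borel_measurable_sum pm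
        borel_measurable_integrable[OF vm])
  also have "\<dots> = (\<Sum>j\<in>J. \<integral>\<omega>. claim_coeff \<rho> T s (a j) (K j) \<bullet> ?v j \<omega> \<partial>Q)"
    by (rule Bochner_Integration.integral_sum) (rule vm)
  also have "\<dots> = (\<Sum>j\<in>J. claim_coeff \<rho> T s (a j) (K j) \<bullet> (\<integral>\<omega>. ?v j \<omega> \<partial>Q))"
    by (intro sum.cong refl integral_inner_right v)
  finally show ?thesis .
qed

end

section \<open>The limit experiment\<close>

lemma limit_price_eq: "limit_price \<rho> s T \<omega> $ i = bond \<rho> T * (s $ i * \<omega> T $ i)"
  by (simp add: limit_price_def mult_ac)

lemma standard_experiment_mean:
  assumes E: "standard_experiment I \<nu> \<nu>s" and I: "I \<subseteq> {0..T}" "T \<in> I"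
  shows "integrable \<nu> (\<lambda>\<omega>. \<omega> T $ i)" "(\<integral>\<omega>. \<omega> T $ i \<partial>\<nu>) = 1"
proof -
  have \<nu>: "sets \<nu> = sets (path_space I)" "prob_space (\<nu>s i)"
    using E by (auto simp: standard_experiment_def)
  have m: "(\<lambda>\<omega>. \<omega> T $ i) \<in> borel_measurable \<nu>"
    unfolding measurable_cong_sets[OF \<nu>(1) refl]
    by (rule measurable_compose[OF measurable_path_coordinate_borel[OF I(2)]])
      (intro borel_measurable_continuous_onI continuous_intros)
  have nn: "0 \<le> \<omega> T $ i" if "\<omega> \<in> space \<nu>" for \<omega>
    using that path_space_nonneg[OF _ I(2)] sets_eq_imp_space_eq[OF \<nu>(1)] by simp
  have "prob_space (density \<nu> (\<lambda>\<omega>. ennreal (\<omega> T $ i)))"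
    using \<nu>(2) by (simp add: standard_experiment_density[OF E I])
  then show "integrable \<nu> (\<lambda>\<omega>. \<omega> T $ i)" "(\<integral>\<omega>. \<omega> T $ i \<partial>\<nu>) = 1"
    using m nn by (auto intro: prob_density_integral_1)
qed

text \<open>The components of the moment vector of \<open>\<phi>\<close> are \<open>E\<^sub>\<nu> \<phi>\<close> and, by change of measure with the density
\<open>\<pi>\<^sup>i\<^sub>T\<close>, the expectations \<open>E\<^bsub>\<nu>\<^sub>i\<^esub> \<phi>\<close>.\<close>

lemma limit_claim_value:
  assumes E: "standard_experiment I \<nu> \<nu>s" and I: "I \<subseteq> {0..T}" "T \<in> I" and \<phi>: "\<phi> \<in> tests I"
  shows "claim_coeff \<rho> T s a K \<bullet> (\<integral>\<omega>. \<phi> \<omega> *\<^sub>R (1, \<omega> T) \<partial>\<nu>)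
    = (\<Sum>i\<in>UNIV. a $ i * s $ i * (\<integral>\<omega>. \<phi> (coordinate_path I \<omega>) \<partial>\<nu>s i))
      - exp (- (LINT u:{0..T}|lebesgue. \<rho> u)) * K * (\<integral>\<omega>. \<phi> (coordinate_path I \<omega>) \<partial>\<nu>)"
proof -
  have \<nu>: "prob_space \<nu>" "sets \<nu> = sets (path_space I)" and \<nu>s: "sets (\<nu>s i) = sets (path_space I)" for i
    using E by (auto simp: standard_experiment_def)
  have \<phi>\<nu>: "\<phi> \<in> tests_on \<nu>"
    using \<phi> by (simp add: tests_def measurable_cong_sets[OF \<nu>(2) refl])
  have coord: "coordinate_path I \<omega> = \<omega>" if "\<omega> \<in> space (path_space I)" for \<omega>
    using that by (auto simp: coordinate_path_def space_path_space fun_eq_iff PiE_def extensional_def)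
  have c\<nu>: "(\<integral>\<omega>. \<phi> (coordinate_path I \<omega>) \<partial>\<nu>) = (\<integral>\<omega>. \<phi> \<omega> \<partial>\<nu>)"
    using sets_eq_imp_space_eq[OF \<nu>(2)] by (intro Bochner_Integration.integral_cong) (auto simp: coord)
  have mean: "integrable \<nu> (\<lambda>\<omega>. \<omega> T $ i)" for i by (rule standard_experiment_mean[OF E I])
  have c\<nu>s: "(\<integral>\<omega>. \<phi> (coordinate_path I \<omega>) \<partial>\<nu>s i) = (\<integral>\<omega>. \<phi> \<omega> * \<omega> T $ i \<partial>\<nu>)" for i
  proof -
    have "(\<integral>\<omega>. \<phi> (coordinate_path I \<omega>) \<partial>\<nu>s i) = (\<integral>\<omega>. \<phi> \<omega> \<partial>\<nu>s i)"
      using sets_eq_imp_space_eq[OF \<nu>s] by (intro Bochner_Integration.integral_cong) (auto simp: coord)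
    also have "\<dots> = (\<integral>\<omega>. \<omega> T $ i * \<phi> \<omega> \<partial>\<nu>)"
      unfolding standard_experiment_density[OF E I]
    proof (rule integral_real_density)
      show "AE \<omega> in \<nu>. 0 \<le> \<omega> T $ i"
        using path_space_nonneg[OF _ I(2)] sets_eq_imp_space_eq[OF \<nu>(2)] by (intro AE_I2) simp
    qed (use tests_onD(1)[OF \<phi>\<nu>] mean[of i] in auto)
    finally show ?thesis by (simp add: mult.commute)
  qed
  have i1: "integrable \<nu> \<phi>" by (rule integrable_test[OF \<nu>(1) \<phi>\<nu>])
  have i2: "integrable \<nu> (\<lambda>\<omega>. \<phi> \<omega> * \<omega> T $ i)" for i
    using integrable_test_scaleR[OF \<phi>\<nu> mean[of i]] by simp
  have "integrable \<nu> (\<lambda>\<omega>. \<phi> \<omega> *\<^sub>R (1 :: real, \<omega> T))"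
    by (intro integrable_test_scaleR[OF \<phi>\<nu>] integral_cash_vec \<nu> standard_experiment_mean[OF E I])
  then have "claim_coeff \<rho> T s a K \<bullet> (\<integral>\<omega>. \<phi> \<omega> *\<^sub>R (1, \<omega> T) \<partial>\<nu>)
      = (\<integral>\<omega>. claim_coeff \<rho> T s a K \<bullet> (\<phi> \<omega> *\<^sub>R (1, \<omega> T)) \<partial>\<nu>)"
    by (intro integral_inner_right[symmetric])
  also have "\<dots> = (\<integral>\<omega>. (\<Sum>i\<in>UNIV. a $ i * s $ i * (\<phi> \<omega> * \<omega> T $ i)) - inverse (bond \<rho> T) * K * \<phi> \<omega> \<partial>\<nu>)"
    by (intro Bochner_Integration.integral_cong refl)
      (simp add: claim_coeff_def inner_vec_def sum_distrib_left algebra_simps)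
  also have "\<dots> = (\<Sum>i\<in>UNIV. a $ i * s $ i * (\<integral>\<omega>. \<phi> \<omega> * \<omega> T $ i \<partial>\<nu>)) - inverse (bond \<rho> T) * K * (\<integral>\<omega>. \<phi> \<omega> \<partial>\<nu>)"
    using i1 i2 by simp
  finally show ?thesis
    by (simp add: c\<nu> c\<nu>s bond_def exp_minus)
qed

lemma normalized_limit_prices:
  assumes "\<omega> \<in> space (path_space I)" "\<And>i. 0 < s $ i"
  shows "normalized_prices I \<rho> s (limit_price \<rho> s) \<omega> = \<omega>"
proof
  fix t
  have "s $ i * bond \<rho> t \<noteq> 0" for i
    using assms(2)[of i] bond_pos[of \<rho> t] by simp
  then show "normalized_prices I \<rho> s (limit_price \<rho> s) \<omega> t = \<omega> t"
    using assms(1)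
    by (auto simp: normalized_prices_def limit_price_def vec_eq_iff space_path_space PiE_def extensional_def)
qed

lemma limit_option_price:
  assumes E: "standard_experiment I \<nu> \<nu>s" and I: "I \<subseteq> {0..T}" "T \<in> I"
    and s: "\<And>i. 0 < s $ i" and \<phi>: "\<And>j. j \<in> J \<Longrightarrow> \<phi> j \<in> tests I"
  shows "j \<in> J \<Longrightarrow> integrable \<nu> (payoff T I \<rho> s (limit_price \<rho> s) (a j) (K j) (\<phi> j))"
    and "option_price \<rho> T \<nu> (\<lambda>\<omega>. \<Sum>j\<in>J. payoff T I \<rho> s (limit_price \<rho> s) (a j) (K j) (\<phi> j) \<omega>)
      = (\<Sum>j\<in>J. claim_coeff \<rho> T s (a j) (K j) \<bullet> (\<integral>\<omega>. \<phi> j \<omega> *\<^sub>R (1, \<omega> T) \<partial>\<nu>))"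
proof -
  have \<nu>: "prob_space \<nu>" "sets \<nu> = sets (path_space I)"
    using E by (auto simp: standard_experiment_def)
  have v: "integrable \<nu> (\<lambda>\<omega>. \<phi> j \<omega> *\<^sub>R (1 :: real, \<omega> T))" if "j \<in> J" for j
  proof (rule integrable_test_scaleR)
    show "\<phi> j \<in> tests_on \<nu>"
      using \<phi>[OF that] by (simp add: tests_def measurable_cong_sets[OF \<nu>(2) refl])
    show "integrable \<nu> (\<lambda>\<omega>. (1 :: real, \<omega> T))"
      by (intro integral_cash_vec \<nu> standard_experiment_mean[OF E I])
  qed
  have eq: "inverse (bond \<rho> T) * payoff T I \<rho> s (limit_price \<rho> s) (a j) (K j) (\<phi> j) \<omega>
      = claim_coeff \<rho> T s (a j) (K j) \<bullet> (\<phi> j \<omega> *\<^sub>R (1, \<omega> T))" if "\<omega> \<in> space \<nu>" for \<omega> j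
    using discounted_payoff_eq_inner[of "limit_price \<rho> s" T \<omega> \<rho> s "\<omega> T" I "a j" "K j" "\<phi> j"]
      normalized_limit_prices[of \<omega> I s \<rho>] that sets_eq_imp_space_eq[OF \<nu>(2)] s
    by (simp only: limit_price_eq)
  have "integrable \<nu> (\<lambda>\<omega>. inverse (bond \<rho> T) * payoff T I \<rho> s (limit_price \<rho> s) (a j) (K j) (\<phi> j) \<omega>)"
    if "j \<in> J" for j
    by (subst Bochner_Integration.integrable_cong[OF refl eq]) (assumption | intro integrable_inner_right v that)+
  then show "integrable \<nu> (payoff T I \<rho> s (limit_price \<rho> s) (a j) (K j) (\<phi> j))" if "j \<in> J"
    using that less_imp_neq[OF bond_pos, of \<rho> T] by auto
  have "option_price \<rho> T \<nu> (\<lambda>\<omega>. \<Sum>j\<in>J. payoff T I \<rho> s (limit_price \<rho> s) (a j) (K j) (\<phi> j) \<omega>)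
      = (\<integral>\<omega>. (\<Sum>j\<in>J. claim_coeff \<rho> T s (a j) (K j) \<bullet> (\<phi> j \<omega> *\<^sub>R (1, \<omega> T))) \<partial>\<nu>)"
    unfolding option_price_def
    by (intro Bochner_Integration.integral_cong refl) (simp only: sum_distrib_left eq)
  also have "\<dots> = (\<Sum>j\<in>J. \<integral>\<omega>. claim_coeff \<rho> T s (a j) (K j) \<bullet> (\<phi> j \<omega> *\<^sub>R (1, \<omega> T)) \<partial>\<nu>)"
    by (rule Bochner_Integration.integral_sum) (intro integrable_inner_right v)
  also have "\<dots> = (\<Sum>j\<in>J. claim_coeff \<rho> T s (a j) (K j) \<bullet> (\<integral>\<omega>. \<phi> j \<omega> *\<^sub>R (1, \<omega> T) \<partial>\<nu>))"
    by (intro sum.cong refl integral_inner_right v)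
  finally show "option_price \<rho> T \<nu> (\<lambda>\<omega>. \<Sum>j\<in>J. payoff T I \<rho> s (limit_price \<rho> s) (a j) (K j) (\<phi> j) \<omega>)
      = (\<Sum>j\<in>J. claim_coeff \<rho> T s (a j) (K j) \<bullet> (\<integral>\<omega>. \<phi> j \<omega> *\<^sub>R (1, \<omega> T) \<partial>\<nu>))" .
qed

section \<open>Convergence of option prices along the net\<close>

lemma tail_filter_neq_bot:
  assumes "kelley_subnet D le h"
  shows "tail_filter D le \<noteq> bot"
proof -
  have d: "directed_set D le" using assms by (simp add: kelley_subnet_def)
  have "\<not> (\<exists>\<tau>0\<in>D. \<forall>\<tau>\<in>D. le \<tau>0 \<tau> \<longrightarrow> False)"
    using d unfolding directed_set_def by blast
  then show ?thesis
    by (simp only: trivial_limit_def eventually_tail_filter[OF d] not_False_eq_True)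
qed

lemma filterlim_kelley_subnet:
  assumes "kelley_subnet D le h"
  shows "filterlim h at_top (tail_filter D le)"
proof -
  have d: "directed_set D le" using assms by (simp add: kelley_subnet_def)
  show ?thesis
    using assms unfolding filterlim_at_top eventually_tail_filter[OF d] kelley_subnet_def by blast
qed

lemma limits_of_market_tests_attained:
  fixes X :: "nat \<Rightarrow> real \<Rightarrow> 'w \<Rightarrow> real ^ 'd" and J :: "nat set"
  assumes I: "I \<subseteq> {0..T}" "0 \<in> I" "T \<in> I"
    and experiments: "\<And>n. financial_experiment (P n) T I (F n) (X n) (Q n) (Qs n)"
    and accumulation: "accumulation_point_along D le h I X Q Qs \<nu> \<nu>s"
    and \<psi>: "\<And>n j. j \<in> J \<Longrightarrow> \<psi> n j \<in> tests_on (Q n)"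
  obtains r :: "nat \<Rightarrow> nat" and \<phi> where "strict_mono r" "\<And>j. j \<in> J \<Longrightarrow> \<phi> j \<in> tests I"
    "\<And>j. j \<in> J \<Longrightarrow>
      (\<lambda>k. \<integral>\<omega>. \<psi> (r k) j \<omega> *\<^sub>R (1 :: real, relative_prices I (X (r k)) \<omega> T) \<partial>Q (r k))
        \<longlonglongrightarrow> (\<integral>\<omega>. \<phi> j \<omega> *\<^sub>R (1, \<omega> T) \<partial>\<nu>)"
proof -
  have E: "standard_experiment I \<nu> \<nu>s" and net: "kelley_subnet D le h"
    and fidi: "fidi_conv_along I
        (\<lambda>\<tau>. distr (Q (h \<tau>)) (path_space I) (relative_prices I (X (h \<tau>)))) \<nu> (tail_filter D le)"
    using accumulation by (auto simp: accumulation_point_along_def)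
  have \<nu>: "prob_space \<nu>" "sets \<nu> = sets (path_space I)"
    using E by (auto simp: standard_experiment_def)
  have Q: "prob_space (Q n)" for n
    by (rule financial_experiment.Q_prob[OF experiments])
  have Y: "relative_prices I (X n) \<in> Q n \<rightarrow>\<^sub>M path_space I" for n
    by (rule financial_experiment.relative_prices_measurable[OF experiments I(2)])
  note limit_vec = integral_cash_vec[OF \<nu>(1) standard_experiment_mean[OF E I(1,3)]]
  note market_vec = integral_cash_vec[OF Q financial_experiment.relative_prices_mean[OF experiments I(2,3)]]
  show ?thesis
  proof (rule limits_of_tests_attained[where M=\<nu> and N=Q and w="\<lambda>\<omega>. (1 :: real, \<omega> T)"
        and W="\<lambda>n \<omega>. (1 :: real, relative_prices I (X n) \<omega> T)" and F="tail_filter D le" and h=h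
        and J=J and \<psi>=\<psi>])
    show "(\<integral>\<omega>. (1 :: real, relative_prices I (X n) \<omega> T) \<partial>Q n) = (\<integral>\<omega>. (1, \<omega> T) \<partial>\<nu>)" for n
      by (simp only: limit_vec market_vec)
    show "0 \<le> (1 :: real, \<omega> T) \<bullet> b" if "\<omega> \<in> space \<nu>" "b \<in> Basis" for \<omega> b
      using that path_space_nonneg[OF _ I(3)] sets_eq_imp_space_eq[OF \<nu>(2)]
      by (intro Basis_inner_cash_vec_nonneg) auto
    show "0 \<le> (1 :: real, relative_prices I (X n) \<omega> T) \<bullet> b" if "\<omega> \<in> space (Q n)" "b \<in> Basis" for n \<omega> b
      using path_space_nonneg[OF measurable_space[OF Y that(1)] I(3)] that(2)
      by (intro Basis_inner_cash_vec_nonneg)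
    fix f :: "real \<times> (real ^ 'd) \<Rightarrow> real"
    assume f: "continuous_on UNIV f" "bounded (range f)"
    have c: "continuous_on UNIV (\<lambda>y. f (1, y))"
      by (rule continuous_on_compose2[OF f(1)]) (auto intro!: continuous_intros)
    have b: "bounded (range (\<lambda>y. f (1, y)))"
      by (rule bounded_subset[OF f(2)]) auto
    have m: "(\<lambda>\<omega>. f (1, \<omega> T)) \<in> borel_measurable (path_space I)"
      by (rule measurable_compose[OF measurable_path_coordinate_borel[OF I(3)] borel_measurable_continuous_onI[OF c]])
    have "((\<lambda>\<tau>. \<integral>\<omega>. f (1, \<omega> T) \<partial>distr (Q (h \<tau>)) (path_space I) (relative_prices I (X (h \<tau>))))
        \<longlongrightarrow> (\<integral>\<omega>. f (1, \<omega> T) \<partial>\<nu>)) (tail_filter D le)"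
      by (rule fidi_conv_along_coordinate[OF fidi I(3) _ \<nu>(2) c b]) simp
    then show "((\<lambda>\<tau>. \<integral>\<omega>. f (1, relative_prices I (X (h \<tau>)) \<omega> T) \<partial>Q (h \<tau>))
        \<longlongrightarrow> (\<integral>\<omega>. f (1, \<omega> T) \<partial>\<nu>)) (tail_filter D le)"
      by (simp only: integral_distr[OF Y m])
  next
    fix r \<phi>
    assume "strict_mono r" and "\<And>j. j \<in> J \<Longrightarrow> \<phi> j \<in> tests_on \<nu>"
      and "\<And>j. j \<in> J \<Longrightarrow>
      (\<lambda>k. \<integral>\<omega>. \<psi> (r k) j \<omega> *\<^sub>R (1 :: real, relative_prices I (X (r k)) \<omega> T) \<partial>Q (r k))
        \<longlonglongrightarrow> (\<integral>\<omega>. \<phi> j \<omega> *\<^sub>R (1, \<omega> T) \<partial>\<nu>)"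
    then show ?thesis
      by (intro that[of r \<phi>]) (simp_all add: tests_def measurable_cong_sets[OF \<nu>(2) refl])
  qed (use \<nu> Q \<psi> limit_vec(1) market_vec(1) tail_filter_neq_bot[OF net] filterlim_kelley_subnet[OF net] in auto)
qed

text \<open>Prices are inner products of convergent coefficient vectors with convergent moment vectors.\<close>

lemma option_price_convergence:
  fixes X :: "nat \<Rightarrow> real \<Rightarrow> 'w \<Rightarrow> real ^ 'd" and an :: "nat \<Rightarrow> nat \<Rightarrow> real ^ 'd"
  assumes I: "I \<subseteq> {0..T}" "0 \<in> I" "T \<in> I"
    and experiments: "\<And>n. financial_experiment (P n) T I (F n) (X n) (Q n) (Qs n)"
    and accumulation: "accumulation_point_along D le h I X Q Qs \<nu> \<nu>s"
    and initial: "\<And>n i. AE \<omega> in P n. price \<rho> (X n) 0 \<omega> $ i = s0 n $ i"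
    and s0_pos: "\<And>n i. 0 < s0 n $ i" and s_pos: "\<And>i. 0 < s $ i"
    and s0_conv: "\<And>i. (\<lambda>n. s0 n $ i) \<longlonglongrightarrow> s $ i"
    and a: "\<And>j i. j \<in> J \<Longrightarrow> (\<lambda>n. an n j $ i) \<longlonglongrightarrow> a j $ i"
    and K: "\<And>j. j \<in> J \<Longrightarrow> (\<lambda>n. Kn n j) \<longlonglongrightarrow> K j"
    and \<phi>n: "\<And>n j. j \<in> J \<Longrightarrow> \<phi>n n j \<in> tests I"
  obtains r :: "nat \<Rightarrow> nat" and \<phi> where "strict_mono r" "\<And>j. j \<in> J \<Longrightarrow> \<phi> j \<in> tests I"
    "(\<lambda>k. option_price \<rho> T (Q (r k)) (\<lambda>\<omega>. \<Sum>j\<in>J. payoff T I \<rho> (s0 (r k)) (price \<rho> (X (r k)))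
        (an (r k) j) (Kn (r k) j) (\<phi>n (r k) j) \<omega>))
      \<longlonglongrightarrow> option_price \<rho> T \<nu> (\<lambda>\<omega>. \<Sum>j\<in>J. payoff T I \<rho> s (limit_price \<rho> s) (a j) (K j) (\<phi> j) \<omega>)"
proof -
  define \<psi> where "\<psi> n j \<omega> = \<phi>n n j (normalized_prices I \<rho> (s0 n) (price \<rho> (X n)) \<omega>)" for n j \<omega>
  have E: "standard_experiment I \<nu> \<nu>s"
    using accumulation by (simp add: accumulation_point_along_def)
  have "\<psi> n j \<in> tests_on (Q n)" if "j \<in> J" for n j
    unfolding \<psi>_def
    using measurable_compose[OF financial_experiment.normalized_prices_measurable[OF experiments s0_pos]]
      \<phi>n[OF that] unfolding tests_def by blast
  then obtain r \<phi> where r: "strict_mono r" and \<phi>: "\<And>j. j \<in> J \<Longrightarrow> \<phi> j \<in> tests I"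
    and lim: "\<And>j. j \<in> J \<Longrightarrow>
      (\<lambda>k. \<integral>\<omega>. \<psi> (r k) j \<omega> *\<^sub>R (1 :: real, relative_prices I (X (r k)) \<omega> T) \<partial>Q (r k))
        \<longlonglongrightarrow> (\<integral>\<omega>. \<phi> j \<omega> *\<^sub>R (1, \<omega> T) \<partial>\<nu>)"
    using limits_of_market_tests_attained[OF I experiments accumulation, of J \<psi>] by blast
  have coeff: "(\<lambda>k. claim_coeff \<rho> T (s0 (r k)) (an (r k) j) (Kn (r k) j)) \<longlonglongrightarrow> claim_coeff \<rho> T s (a j) (K j)"
    if j: "j \<in> J" for j
  proof -
    have sub: "(\<lambda>k. x (r k)) \<longlonglongrightarrow> y" if "x \<longlonglongrightarrow> y" for x and y :: real
      using LIMSEQ_subseq_LIMSEQ[OF that r] by (simp add: o_def)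
    show ?thesis
      unfolding claim_coeff_def
      by (intro tendsto_Pair vec_tendstoI) (auto intro!: tendsto_intros sub[OF K[OF j]] sub[OF a[OF j]] sub[OF s0_conv])
  qed
  have "(\<lambda>k. \<Sum>j\<in>J. claim_coeff \<rho> T (s0 (r k)) (an (r k) j) (Kn (r k) j) \<bullet>
        (\<integral>\<omega>. \<psi> (r k) j \<omega> *\<^sub>R (1, relative_prices I (X (r k)) \<omega> T) \<partial>Q (r k)))
      \<longlonglongrightarrow> (\<Sum>j\<in>J. claim_coeff \<rho> T s (a j) (K j) \<bullet> (\<integral>\<omega>. \<phi> j \<omega> *\<^sub>R (1, \<omega> T) \<partial>\<nu>))"
    by (intro tendsto_sum tendsto_inner coeff lim)
  then have "(\<lambda>k. option_price \<rho> T (Q (r k)) (\<lambda>\<omega>. \<Sum>j\<in>J. payoff T I \<rho> (s0 (r k)) (price \<rho> (X (r k)))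
        (an (r k) j) (Kn (r k) j) (\<phi>n (r k) j) \<omega>))
      \<longlonglongrightarrow> option_price \<rho> T \<nu> (\<lambda>\<omega>. \<Sum>j\<in>J. payoff T I \<rho> s (limit_price \<rho> s) (a j) (K j) (\<phi> j) \<omega>)"
    unfolding \<psi>_def
    by (simp only: limit_option_price(2)[OF E I(1,3) s_pos \<phi>]
        financial_experiment.option_price_as_moments[OF experiments I(2,3) s0_pos initial \<phi>n])
  then show ?thesis using that[of r \<phi>] r \<phi> by blast
qed

theorem theorem5p5:
  fixes T :: real and I :: "real set"
    and P Q :: "nat \<Rightarrow> 'w measure" and F :: "nat \<Rightarrow> real \<Rightarrow> 'w measure"
    and X :: "nat \<Rightarrow> real \<Rightarrow> 'w \<Rightarrow> real ^ 'd" and Qs :: "nat \<Rightarrow> 'd \<Rightarrow> 'w measure"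
    and \<nu> :: "(real \<Rightarrow> real ^ 'd) measure" and \<nu>s :: "'d \<Rightarrow> (real \<Rightarrow> real ^ 'd) measure"
    and D :: "'i set" and le :: "'i \<Rightarrow> 'i \<Rightarrow> bool" and h :: "'i \<Rightarrow> nat"
    and \<rho> :: "real \<Rightarrow> real" and s0 :: "nat \<Rightarrow> real ^ 'd" and s :: "real ^ 'd"
  assumes T_pos: "0 < T" and I_sub: "I \<subseteq> {0..T}" and I_ends: "{0, T} \<subseteq> I"
    and experiments: "\<And>n. financial_experiment (P n) T I (F n) (X n) (Q n) (Qs n)"
    and contig1: "\<And>i. contiguous (\<lambda>n. Qs n i) Q"
    and contig2: "\<And>i. contiguous Q (\<lambda>n. Qs n i)"
    and accumulation: "accumulation_point_along D le h I X Q Qs \<nu> \<nu>s"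
    and rho: "\<rho> absolutely_integrable_on {0..T}"
    and initial: "\<And>n i. AE \<omega> in P n. price \<rho> (X n) 0 \<omega> $ i = s0 n $ i"
    and s0_pos: "\<And>n i. 0 < s0 n $ i" and s_pos: "\<And>i. 0 < s $ i"
    and s0_conv: "\<And>i. (\<lambda>n. s0 n $ i) \<longlonglongrightarrow> s $ i"
  shows
   "(\<forall>t\<in>I. \<forall>i. AE \<omega> in \<nu>. limit_price \<rho> s t \<omega> $ i =
       s $ i * bond \<rho> t *
       enn2real (RN_deriv (restr_to_subalg \<nu> (path_filtration I t))
                          (restr_to_subalg (\<nu>s i) (path_filtration I t)) \<omega>))
    \<and>
    (\<forall>(an :: nat \<Rightarrow> real ^ 'd) a Kn K \<phi>n.
       (\<forall>i. (\<lambda>n. an n $ i) \<longlonglongrightarrow> a $ i) \<and> Kn \<longlonglongrightarrow> K \<and> (\<forall>n. \<phi>n n \<in> tests I)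
       \<longrightarrow> (\<exists>(r :: nat \<Rightarrow> nat) \<phi> H.
          strict_mono r \<and> \<phi> \<in> tests I \<and> integrable \<nu> H \<and>
          (\<forall>\<omega>\<in>space \<nu>. H \<omega> = payoff T I \<rho> s (limit_price \<rho> s) a K \<phi> \<omega>) \<and>
          (\<lambda>k. option_price \<rho> T (Q (r k))
                 (payoff T I \<rho> (s0 (r k)) (price \<rho> (X (r k))) (an (r k)) (Kn (r k)) (\<phi>n (r k))))
            \<longlonglongrightarrow> option_price \<rho> T \<nu> H \<and>
          option_price \<rho> T \<nu> H =
            (\<Sum>i\<in>UNIV. a $ i * s $ i * (\<integral>\<omega>. \<phi> (coordinate_path I \<omega>) \<partial>\<nu>s i))
            - exp (- (LINT u:{0..T}|lebesgue. \<rho> u)) * K * (\<integral>\<omega>. \<phi> (coordinate_path I \<omega>) \<partial>\<nu>)))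
    \<and>
    (\<forall>(m :: nat) (an :: nat \<Rightarrow> nat \<Rightarrow> real ^ 'd) a Kn K \<phi>n.
       (\<forall>j\<in>{1..m}. (\<forall>i. (\<lambda>n. an n j $ i) \<longlonglongrightarrow> a j $ i) \<and> (\<lambda>n. Kn n j) \<longlonglongrightarrow> K j \<and>
          (\<forall>n. \<phi>n n j \<in> tests I))
       \<longrightarrow> (\<exists>(r :: nat \<Rightarrow> nat) \<phi> H.
          strict_mono r \<and> (\<forall>j\<in>{1..m}. \<phi> j \<in> tests I \<and> integrable \<nu> (H j) \<and>
            (\<forall>\<omega>\<in>space \<nu>. H j \<omega> = payoff T I \<rho> s (limit_price \<rho> s) (a j) (K j) (\<phi> j) \<omega>)) \<and>
          (\<lambda>k. option_price \<rho> T (Q (r k))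
                 (\<lambda>\<omega>. \<Sum>j=1..m. payoff T I \<rho> (s0 (r k)) (price \<rho> (X (r k)))
                    (an (r k) j) (Kn (r k) j) (\<phi>n (r k) j) \<omega>))
            \<longlonglongrightarrow> option_price \<rho> T \<nu> (\<lambda>\<omega>. \<Sum>j=1..m. H j \<omega>) \<and>
          option_price \<rho> T \<nu> (\<lambda>\<omega>. \<Sum>j=1..m. H j \<omega>) =
            (\<Sum>j=1..m. (\<Sum>i\<in>UNIV. a j $ i * s $ i * (\<integral>\<omega>. \<phi> j (coordinate_path I \<omega>) \<partial>\<nu>s i))
              - exp (- (LINT u:{0..T}|lebesgue. \<rho> u)) * K j * (\<integral>\<omega>. \<phi> j (coordinate_path I \<omega>) \<partial>\<nu>))))"
proof -
  have I: "I \<subseteq> {0..T}" "0 \<in> I" "T \<in> I" using I_sub I_ends by auto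
  have E: "standard_experiment I \<nu> \<nu>s"
    using accumulation by (simp add: accumulation_point_along_def)
  have sums: "\<exists>(r :: nat \<Rightarrow> nat) \<phi> H.
          strict_mono r \<and> (\<forall>j\<in>{1..m}. \<phi> j \<in> tests I \<and> integrable \<nu> (H j) \<and>
            (\<forall>\<omega>\<in>space \<nu>. H j \<omega> = payoff T I \<rho> s (limit_price \<rho> s) (a j) (K j) (\<phi> j) \<omega>)) \<and>
          (\<lambda>k. option_price \<rho> T (Q (r k))
                 (\<lambda>\<omega>. \<Sum>j=1..m. payoff T I \<rho> (s0 (r k)) (price \<rho> (X (r k)))
                    (an (r k) j) (Kn (r k) j) (\<phi>n (r k) j) \<omega>))
            \<longlonglongrightarrow> option_price \<rho> T \<nu> (\<lambda>\<omega>. \<Sum>j=1..m. H j \<omega>) \<and>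
          option_price \<rho> T \<nu> (\<lambda>\<omega>. \<Sum>j=1..m. H j \<omega>) =
            (\<Sum>j=1..m. (\<Sum>i\<in>UNIV. a j $ i * s $ i * (\<integral>\<omega>. \<phi> j (coordinate_path I \<omega>) \<partial>\<nu>s i))
              - exp (- (LINT u:{0..T}|lebesgue. \<rho> u)) * K j * (\<integral>\<omega>. \<phi> j (coordinate_path I \<omega>) \<partial>\<nu>))"
    if lim: "\<forall>j\<in>{1..m}. (\<forall>i. (\<lambda>n. an n j $ i) \<longlonglongrightarrow> a j $ i) \<and> (\<lambda>n. Kn n j) \<longlonglongrightarrow> K j \<and>
          (\<forall>n. \<phi>n n j \<in> tests I)"
    for m :: nat and an :: "nat \<Rightarrow> nat \<Rightarrow> real ^ 'd" and a Kn K \<phi>n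
  proof -
    obtain r :: "nat \<Rightarrow> nat" and \<phi> where r: "strict_mono r" and \<phi>: "\<And>j. j \<in> {1..m} \<Longrightarrow> \<phi> j \<in> tests I"
      and conv: "(\<lambda>k. option_price \<rho> T (Q (r k)) (\<lambda>\<omega>. \<Sum>j=1..m. payoff T I \<rho> (s0 (r k)) (price \<rho> (X (r k)))
          (an (r k) j) (Kn (r k) j) (\<phi>n (r k) j) \<omega>))
        \<longlonglongrightarrow> option_price \<rho> T \<nu> (\<lambda>\<omega>. \<Sum>j=1..m. payoff T I \<rho> s (limit_price \<rho> s) (a j) (K j) (\<phi> j) \<omega>)"
      by (rule option_price_convergence[OF I experiments accumulation initial s0_pos s_pos s0_conv,
            of "{1..m}" an a Kn K \<phi>n]) (use lim in blast)+
    let ?H = "\<lambda>j. payoff T I \<rho> s (limit_price \<rho> s) (a j) (K j) (\<phi> j)"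
    note limit = limit_option_price[where J="{1..m}" and \<phi>=\<phi> and a=a and K=K, OF E I(1,3) s_pos \<phi>]
    have val: "option_price \<rho> T \<nu> (\<lambda>\<omega>. \<Sum>j=1..m. ?H j \<omega>) =
            (\<Sum>j=1..m. (\<Sum>i\<in>UNIV. a j $ i * s $ i * (\<integral>\<omega>. \<phi> j (coordinate_path I \<omega>) \<partial>\<nu>s i))
              - exp (- (LINT u:{0..T}|lebesgue. \<rho> u)) * K j * (\<integral>\<omega>. \<phi> j (coordinate_path I \<omega>) \<partial>\<nu>))"
      by (subst limit(2)) (assumption | intro sum.cong refl limit_claim_value[OF E I(1,3)] \<phi>)+
    show ?thesis
      by (intro exI[of _ r] exI[of _ \<phi>] exI[of _ ?H] conjI ballI r \<phi> limit(1) conv val refl)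
  qed
  have ball_singleton: "(\<forall>j\<in>{i}. R j) \<longleftrightarrow> R i" for R :: "nat \<Rightarrow> bool" and i by simp
  have sum_singleton: "(\<Sum>j\<in>{i}. f j) = f i" for f :: "nat \<Rightarrow> real" and i by simp
  show ?thesis
  proof (intro conjI allI impI ballI)
    fix t i assume t: "t \<in> I"
    then have "0 \<le> t" using I_sub by auto
    from coordinate_is_RN_deriv[OF E t this, of i]
    show "AE \<omega> in \<nu>. limit_price \<rho> s t \<omega> $ i = s $ i * bond \<rho> t *
       enn2real (RN_deriv (restr_to_subalg \<nu> (path_filtration I t))
                          (restr_to_subalg (\<nu>s i) (path_filtration I t)) \<omega>)"
      by eventually_elim (simp add: limit_price_def)
  next
    fix an :: "nat \<Rightarrow> real ^ 'd" and a and Kn :: "nat \<Rightarrow> real" and K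
      and \<phi>n :: "nat \<Rightarrow> (real \<Rightarrow> real ^ 'd) \<Rightarrow> real"
    assume "(\<forall>i. (\<lambda>n. an n $ i) \<longlonglongrightarrow> a $ i) \<and> Kn \<longlonglongrightarrow> K \<and> (\<forall>n. \<phi>n n \<in> tests I)"
    then have "\<forall>j\<in>{1..1::nat}. (\<forall>i. (\<lambda>n. an n $ i) \<longlonglongrightarrow> a $ i) \<and> Kn \<longlonglongrightarrow> K \<and> (\<forall>n. \<phi>n n \<in> tests I)"
      by blast
    \<comment> \<open>A single claim is the sum over the index set \<open>{1..1}\<close>.\<close>
    from sums[of 1 "\<lambda>n _. an n" "\<lambda>_. a" "\<lambda>n _. Kn n" "\<lambda>_. K" "\<lambda>n _. \<phi>n n", OF this]
    show "\<exists>(r :: nat \<Rightarrow> nat) \<phi> H.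
          strict_mono r \<and> \<phi> \<in> tests I \<and> integrable \<nu> H \<and>
          (\<forall>\<omega>\<in>space \<nu>. H \<omega> = payoff T I \<rho> s (limit_price \<rho> s) a K \<phi> \<omega>) \<and>
          (\<lambda>k. option_price \<rho> T (Q (r k))
                 (payoff T I \<rho> (s0 (r k)) (price \<rho> (X (r k))) (an (r k)) (Kn (r k)) (\<phi>n (r k))))
            \<longlonglongrightarrow> option_price \<rho> T \<nu> H \<and>
          option_price \<rho> T \<nu> H =
            (\<Sum>i\<in>UNIV. a $ i * s $ i * (\<integral>\<omega>. \<phi> (coordinate_path I \<omega>) \<partial>\<nu>s i))
            - exp (- (LINT u:{0..T}|lebesgue. \<rho> u)) * K * (\<integral>\<omega>. \<phi> (coordinate_path I \<omega>) \<partial>\<nu>)"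
      unfolding atLeastAtMost_singleton sum_singleton ball_singleton
      by (elim exE conjE) (rule exI, rule exI, rule exI, intro conjI; assumption)
  qed (rule sums)
qed

end
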